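(* Let $F\subset\mathbb{R}^d$ be a bounded Caccioppoli set. Let $U=(u_1,u_2,\dots)$ be a random sequence of directions chosen independently and uniformly in $S^{d-1}/{\sim}$. Then with probability $1$ the successive random Steiner symmetrizations $F_n=S_{U_n}F=S_{u_n}S_{u_{n-1}}\cdots S_{u_1}F$ converge, with respect to the Nikodym distance, to the ball $B(o,\rho(F))$; that is, almost surely $\lambda_d\big(F_n\bigtriangleup B(o,\rho(F))\big)\to 0$ as $n\to\infty$.
   Context: $\lambda_d$ is $d$-dimensional Lebesgue measure on $\mathbb{R}^d$; $o$ is the origin; $B(q,r)$ is the closed ball with center $q$ and radius $r$; $\kappa_d=\lambda_d(B(o,1))$. For a bounded measurable set $A$, $\rho(A)=(\lambda_d(A)/\kappa_d)^{1/d}$, so $B(o,\rho(A))$ has the same volume as $A$. The Nikodym distance is $d_N(A,B)=\lambda_d(A\bigtriangleup B)$. Caccioppoli set: a measurable set $C\subset\mathbb{R}^d$ such that for some constant $p$, $\lambda_d((C+h)\bigtriangleup C)\le p\,|h|$ for every $h\in\mathbb{R}^d$. Steiner symmetral: for a measurable set $A\subset\mathbb{R}^d$ and a unit vector $u$, let $l_u$ be the line through $o$ parallel to $u$ and $u^\perp$ the hyperplane through $o$ orthogonal to $u$. For $x\in u^\perp$ let $c(x)=\emptyset$ if $A\cap(l_u+x)=\emptyset$, and otherwise let $c(x)$ be the (possibly degenerate, possibly infinite) closed segment on $l_u+x$ centered at $x$ whose length is $\lambda^*(A\cap(l_u+x))$, where $\lambda^*$ is one-dimensional outer Lebesgue measure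 on the line. Then $S_uA=\bigcup_{x\in u^\perp}c(x)$. Note $S_u=S_{-u}$. Directions: $S^{d-1}/{\sim}$ is the unit sphere with $u$ and $-u$ identified, with the probability given by normalized surface area restricted to the symmetric Borel sets of $S^{d-1}$ (Borel sets $D$ with $D=-D$). The random sequence $U=(u_1,u_2,\dots)$ is an element of $\Omega=\prod_{n=1}^\infty (S^{d-1}/{\sim})$ with the product probability, and $U_n=(u_1,\dots,u_n)$. *)

theory Defs
  imports "HOL-Probability.Probability"
begin

definition caccioppoli :: "'a::euclidean_space set \<Rightarrow> bool" where
  "caccioppoli C \<longleftrightarrow> C \<in> sets lebesgue \<and>
     (\<exists>p::real. \<forall>h. emeasure lebesgue (sym_diff ((\<lambda>x. x + h) ` C) C) \<le> ennreal (p * norm h))"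

text \<open>The distance takes values in \<^typ>\<open>ennreal\<close>, so that symmetric differences of infinite
  measure are not sent to 0.\<close>

definition nikodym_dist :: "'a::euclidean_space set \<Rightarrow> 'a set \<Rightarrow> ennreal" where
  "nikodym_dist A B = emeasure lebesgue (sym_diff A B)"

definition vol_radius :: "'a::euclidean_space set \<Rightarrow> real" where
  "vol_radius A = (measure lebesgue A / measure lebesgue (cball (0::'a) 1)) powr (1 / real DIM('a))"

text \<open>The line through \<open>x\<close> parallel to the unit vector \<open>u\<close> is parametrised isometrically by
  \<open>t \<mapsto> x + t u\<close>; one-dimensional outer Lebesgue measure on the line is that of the set of
  parameters \<open>t\<close>.\<close>

definition line_outer_measure :: "'a::euclidean_space \<Rightarrow> 'a \<Rightarrow> 'a set \<Rightarrow> ennreal" where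
  "line_outer_measure u x A = outer_measure_of lebesgue {t::real. x + t *\<^sub>R u \<in> A}"

definition line_through :: "'a::euclidean_space \<Rightarrow> 'a \<Rightarrow> 'a set" where
  "line_through u x = {x + t *\<^sub>R u | t. True}"

text \<open>A point \<open>x + t u\<close> lies in the closed segment of length \<open>L\<close> centred at \<open>x\<close> iff
  \<open>2 \<bar>t\<bar> \<le> L\<close>; for \<open>L = \<infinity>\<close> this is the whole line and for \<open>L = 0\<close> the single point \<open>x\<close>.\<close>

definition steiner_segment :: "'a::euclidean_space \<Rightarrow> 'a set \<Rightarrow> 'a \<Rightarrow> 'a set" where
  "steiner_segment u A x =
     (if A \<inter> line_through u x = {} then {}
      else {x + t *\<^sub>R u | t. ennreal (2 * \<bar>t\<bar>) \<le> line_outer_measure u x A})"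

definition steiner_symmetral :: "'a::euclidean_space \<Rightarrow> 'a set \<Rightarrow> 'a set" where
  "steiner_symmetral u A = (\<Union>x\<in>{x. x \<bullet> u = 0}. steiner_segment u A x)"

text \<open>Sequences are indexed from 0: \<open>U n\<close> is the direction \<open>u\<^sub>n\<^sub>+\<^sub>1\<close>, so that
  \<open>steiner_iter U A n\<close> applies the symmetrizations in \<open>u\<^sub>1, \<dots>, u\<^sub>n\<close>, in this order.\<close>

primrec steiner_iter :: "(nat \<Rightarrow> 'a::euclidean_space) \<Rightarrow> 'a set \<Rightarrow> nat \<Rightarrow> 'a set" where
  "steiner_iter U A 0 = A"
| "steiner_iter U A (Suc n) = steiner_symmetral (U n) (steiner_iter U A n)"

text \<open>Surface area on the unit sphere in polar form: \<open>d\<close> times the volume of the cone over the set.\<close>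

definition sphere_cone :: "'a::euclidean_space set \<Rightarrow> 'a set" where
  "sphere_cone D = {t *\<^sub>R x | t x. 0 < t \<and> t \<le> 1 \<and> x \<in> D}"

definition surface_area :: "'a::euclidean_space set \<Rightarrow> ennreal" where
  "surface_area D = of_nat DIM('a) * emeasure lebesgue (sphere_cone D)"

definition symmetric_borel :: "'a::euclidean_space set set" where
  "symmetric_borel = {D \<in> sets borel. D \<subseteq> sphere 0 1 \<and> uminus ` D = D}"

text \<open>The identification of \<open>u\<close> with \<open>-u\<close> is expressed by the \<open>\<sigma>\<close>-algebra: points remain unit
  vectors, but only symmetric Borel sets are measurable.\<close>

definition direction_measure :: "'a::euclidean_space measure" where
  "direction_measure =
     measure_of (sphere 0 1) symmetric_borel (\<lambda>D. surface_area D / surface_area (sphere (0::'a) 1))"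

definition random_directions :: "(nat \<Rightarrow> 'a::euclidean_space) measure" where
  "random_directions = PiM UNIV (\<lambda>_. direction_measure)"

lemma steiner_symmetral_minus: "steiner_symmetral (- u) A = steiner_symmetral u A"
proof -
  have im: "uminus ` {t::real. x - t *\<^sub>R u \<in> A} = {t. x + t *\<^sub>R u \<in> A}" for x
    by (force simp: image_iff intro: exI[of _ "- _"])
  have le: "outer_measure_of lebesgue (uminus ` T) \<le> outer_measure_of lebesgue T" for T :: "real set"
    unfolding outer_measure_of_def
  proof (rule INF_greatest)
    fix B :: "real set" assume B: "B \<in> {B \<in> sets lebesgue. T \<subseteq> B}"
    have "uminus ` B \<in> sets lebesgue"
    proof -
      have "uminus ` B = (*\<^sub>R) (- 1) -` B" by (force simp: image_iff intro: bexI[of _ "- _"])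
      then show ?thesis
        using B measurable_sets[OF lebesgue_measurable_scaling[of "- 1 :: real"], of B] by simp
    qed
    moreover have "emeasure lebesgue (uminus ` B) = emeasure lebesgue B"
      using emeasure_lebesgue_affine[of "-1" 0 B] by simp
    ultimately show "(INF B\<in>{B \<in> sets lebesgue. uminus ` T \<subseteq> B}. emeasure lebesgue B) \<le> emeasure lebesgue B"
      using B by (intro INF_lower2[of "uminus ` B"]) auto
  qed
  have eq: "outer_measure_of lebesgue (uminus ` T) = outer_measure_of lebesgue T" for T :: "real set"
    using le[of T] le[of "uminus ` T"] by (simp add: image_image)
  have om: "line_outer_measure (- u) x A = line_outer_measure u x A" for x
    using eq[of "{t. x - t *\<^sub>R u \<in> A}"] by (simp add: line_outer_measure_def im)
  have ln: "{x + t *\<^sub>R (- u) | t. P \<bar>t\<bar>} = {x + t *\<^sub>R u | t. P \<bar>t\<bar>}" for x and P :: "real \<Rightarrow> bool"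
    by (auto; metis abs_minus_cancel scaleR_minus_left add_uminus_conv_diff minus_minus)
  have "steiner_segment (- u) A x = steiner_segment u A x" for x
    using ln[of x "\<lambda>_. True"] ln[of x "\<lambda>t. ennreal (2 * t) \<le> line_outer_measure u x A"]
    unfolding steiner_segment_def line_through_def om by simp
  then show ?thesis
    by (simp add: steiner_symmetral_def)
qed

lemma sphere_cone_eq:
  assumes "D \<subseteq> sphere 0 1"
  shows "sphere_cone D = {y. 0 < norm y \<and> norm y \<le> 1 \<and> y /\<^sub>R norm y \<in> D}"
proof (intro set_eqI iffI)
  fix y assume "y \<in> sphere_cone D"
  then obtain t x where "y = t *\<^sub>R x" "0 < t" "t \<le> 1" "x \<in> D"
    by (auto simp: sphere_cone_def)
  moreover have "norm x = 1" "x \<noteq> 0" using assms \<open>x \<in> D\<close> by auto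
  ultimately show "y \<in> {y. 0 < norm y \<and> norm y \<le> 1 \<and> y /\<^sub>R norm y \<in> D}" by simp
next
  fix y assume y: "y \<in> {y. 0 < norm y \<and> norm y \<le> 1 \<and> y /\<^sub>R norm y \<in> D}"
  then have "y = norm y *\<^sub>R (y /\<^sub>R norm y)" by simp
  with y show "y \<in> sphere_cone D" unfolding sphere_cone_def by blast
qed

lemma sphere_cone_borel:
  fixes D :: "'a::euclidean_space set"
  assumes "D \<in> sets borel" "D \<subseteq> sphere 0 1"
  shows "sphere_cone D \<in> sets borel"
proof -
  have "(\<lambda>y::'a. y /\<^sub>R norm y) -` D \<in> sets borel"
    using measurable_sets[OF _ assms(1), of "\<lambda>y::'a. y /\<^sub>R norm y" borel] by simp
  moreover have "{y::'a. 0 < norm y \<and> norm y \<le> 1} \<in> sets borel" by measurable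
  moreover have "sphere_cone D = {y. 0 < norm y \<and> norm y \<le> 1} \<inter> (\<lambda>y. y /\<^sub>R norm y) -` D"
    using sphere_cone_eq[OF assms(2)] by auto
  ultimately show ?thesis by auto
qed

lemma sphere_cone_sphere: "sphere_cone (sphere (0::'a::euclidean_space) 1) = cball 0 1 - {0}"
  by (subst sphere_cone_eq) auto

lemma surface_area_sphere:
  "0 < surface_area (sphere (0::'a::euclidean_space) 1)"
  "surface_area (sphere (0::'a::euclidean_space) 1) < \<infinity>"
proof -
  have "emeasure lebesgue (cball (0::'a) 1 - {0}) = emeasure lebesgue (cball (0::'a) 1)"
    by (intro emeasure_Diff_null_set) (auto intro: null_setsI)
  then have eq: "surface_area (sphere (0::'a) 1) = of_nat DIM('a) * ennreal (unit_ball_vol (real DIM('a)))"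
    by (simp add: surface_area_def sphere_cone_sphere emeasure_cball)
  show "0 < surface_area (sphere (0::'a) 1)" "surface_area (sphere (0::'a) 1) < \<infinity>"
    unfolding eq by (auto simp: ennreal_zero_less_mult_iff ennreal_mult_less_top
      ennreal_of_nat_eq_real_of_nat)
qed

lemma sigma_algebra_symmetric_borel:
  "sigma_algebra (sphere 0 1) (symmetric_borel :: 'a::euclidean_space set set)"
proof (rule sigma_algebra_iff2[THEN iffD2], intro conjI ballI allI impI)
  show "symmetric_borel \<subseteq> Pow (sphere (0::'a) 1)" "{} \<in> (symmetric_borel :: 'a set set)"
    by (auto simp: symmetric_borel_def)
next
  fix D :: "'a set" assume D: "D \<in> symmetric_borel"
  have "uminus ` sphere (0::'a) 1 = sphere 0 1"
    by (force simp: image_iff intro: bexI[of _ "- _"])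
  then have "uminus ` (sphere 0 1 - D) = sphere 0 1 - D"
    using D by (subst image_set_diff) (auto simp: symmetric_borel_def)
  then show "sphere 0 1 - D \<in> symmetric_borel"
    using D by (auto simp: symmetric_borel_def)
next
  fix D :: "nat \<Rightarrow> 'a set" assume "range D \<subseteq> symmetric_borel"
  then have "\<And>i. D i \<in> sets borel \<and> D i \<subseteq> sphere 0 1 \<and> uminus ` D i = D i"
    by (auto simp: symmetric_borel_def)
  moreover from this have "uminus ` (\<Union>i. D i) = (\<Union>i. D i)"
    by (simp add: image_UN)
  ultimately show "(\<Union>i. D i) \<in> symmetric_borel"
    by (auto simp: symmetric_borel_def)
qed

lemma space_direction_measure [simp]: "space direction_measure = sphere 0 1"
  unfolding direction_measure_def by (rule space_measure_of) (auto simp: symmetric_borel_def)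

lemma sets_direction_measure [simp]: "sets direction_measure = symmetric_borel"
  unfolding direction_measure_def
  by (rule sigma_algebra.sets_measure_of_eq[OF sigma_algebra_symmetric_borel])

lemma emeasure_direction_measure:
  fixes D :: "'a::euclidean_space set"
  assumes "D \<in> symmetric_borel"
  shows "emeasure direction_measure D = surface_area D / surface_area (sphere (0::'a) 1)"
  unfolding direction_measure_def
proof (rule emeasure_measure_of_sigma[OF sigma_algebra_symmetric_borel _ _ assms])
  show "positive symmetric_borel (\<lambda>D::'a set. surface_area D / surface_area (sphere (0::'a) 1))"
    by (simp add: positive_def surface_area_def sphere_cone_def)
  show "countably_additive symmetric_borel (\<lambda>D::'a set. surface_area D / surface_area (sphere (0::'a) 1))"
  proof (rule countably_additiveI)
    fix D :: "nat \<Rightarrow> 'a set"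
    assume D: "range D \<subseteq> symmetric_borel" and disj: "disjoint_family D"
    have sub: "D i \<subseteq> sphere 0 1" "D i \<in> sets borel" for i
      using D by (auto simp: symmetric_borel_def)
    have un: "sphere_cone (\<Union>i. D i) = (\<Union>i. sphere_cone (D i))"
      by (auto simp: sphere_cone_def)
    have "sphere_cone (D i) \<in> sets lebesgue" for i
      using sphere_cone_borel[OF sub(2) sub(1), of i] by simp
    moreover have "disjoint_family (\<lambda>i. sphere_cone (D i))"
      using disj by (auto simp: disjoint_family_on_def sphere_cone_eq[OF sub(1)])
    ultimately have "(\<Sum>i. emeasure lebesgue (sphere_cone (D i))) = emeasure lebesgue (sphere_cone (\<Union>i. D i))"
      unfolding un by (intro suminf_emeasure) auto
    then show "(\<Sum>i. surface_area (D i) / surface_area (sphere (0::'a) 1))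
             = surface_area (\<Union>i. D i) / surface_area (sphere (0::'a) 1)"
      by (simp add: surface_area_def ennreal_suminf_divide ennreal_suminf_cmult)
  qed
qed

lemma prob_space_direction_measure: "prob_space (direction_measure :: 'a::euclidean_space measure)"
proof (rule prob_spaceI)
  have "sphere (0::'a) 1 \<in> symmetric_borel"
    using sets.top[of "direction_measure :: 'a measure"] by simp
  then show "emeasure direction_measure (space (direction_measure :: 'a measure)) = 1"
    using surface_area_sphere[where 'a='a]
    by (simp add: emeasure_direction_measure ennreal_divide_self less_top)
qed

end

theory Submission
  imports Defs
begin

text \<open>On a line parallel to \<open>u\<close> the symmetral of \<open>A\<close> and the ball \<open>B\<close> are concentric segments. If
  \<open>A - B\<close> and \<open>B - A\<close> have lengths \<open>a\<close> and \<open>b\<close> there, symmetrization lowers the length \<open>a + b\<close> of the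
  symmetric difference to \<open>\<bar>a - b\<bar>\<close>, that is by \<open>2 min a b \<ge> a b / R\<close> when everything lies in the ball of
  radius \<open>R\<close>. Integrated over all lines, \<open>a b\<close> becomes the integral over \<open>p \<in> A - B\<close> of the length of
  \<open>B - A\<close> on the line through \<open>p\<close> in direction \<open>u\<close>, and the average of this length over \<open>u\<close> is at least
  a constant times \<open>\<bar>B - A\<bar>\<close>. If \<open>\<bar>A\<bar> = \<bar>B\<bar>\<close>, the Nikodym distance \<open>X\<close> to \<open>B\<close> therefore drops on average
  by at least \<open>c X\<^sup>2\<close>. So the expectations of the squares \<open>X\<^sub>n\<^sup>2\<close> are summable, and as \<open>X\<^sub>n\<close> is decreasing
  it tends to 0 almost surely.\<close>

subsection \<open>Integration along parallel lines\<close>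

text \<open>The vector \<open>u\<close> need not be a unit vector, and length is measured in the
  parameter \<open>t\<close>: the average over directions is later computed with all
  \<open>u\<close> in a shell.\<close>

definition line_len :: "'a::euclidean_space \<Rightarrow> 'a set \<Rightarrow> 'a \<Rightarrow> ennreal" where
  "line_len u A y = emeasure lborel {t. y + t *\<^sub>R u \<in> A}"

definition slab :: "'a::euclidean_space \<Rightarrow> 'a set" where
  "slab u = {y. 0 \<le> y \<bullet> u \<and> y \<bullet> u < 1}"

text \<open>A Borel substitute for the Steiner symmetral, equal to it up to a null set: the segments are open,
  so the lines that meet \<open>A\<close> in an empty or null set contribute nothing and no case distinction is needed.\<close>

definition open_symmetral :: "'a::euclidean_space \<Rightarrow> 'a set \<Rightarrow> 'a set" where
  "open_symmetral u A = {z. ennreal (2 * \<bar>z \<bullet> u\<bar>) < line_len u A z}"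

lemma slab_borel [measurable]: "slab u \<in> sets borel"
  unfolding slab_def by measurable

lemma line_section_borel [measurable]:
  fixes A :: "'a::euclidean_space set"
  assumes [measurable]: "A \<in> sets borel"
  shows "{t. y + t *\<^sub>R u \<in> A} \<in> sets borel"
proof -
  have "(\<lambda>t. y + t *\<^sub>R u) -` A \<inter> space borel \<in> sets borel"
    by measurable
  then show ?thesis
    by (simp add: vimage_def)
qed

lemma line_len_eq_nn_integral:
  assumes "A \<in> sets borel"
  shows "line_len u A y = (\<integral>\<^sup>+t. indicator A (y + t *\<^sub>R u) \<partial>lborel)"
proof -
  have "(\<integral>\<^sup>+t. indicator A (y + t *\<^sub>R u) \<partial>lborel) = (\<integral>\<^sup>+t. indicator {t. y + t *\<^sub>R u \<in> A} t \<partial>lborel)"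
    by (intro nn_integral_cong) (auto split: split_indicator)
  then show ?thesis
    using line_section_borel[OF assms, of y u] by (simp add: line_len_def)
qed

lemma line_len_mono: "A \<subseteq> B \<Longrightarrow> B \<in> sets borel \<Longrightarrow> line_len u A y \<le> line_len u B y"
  unfolding line_len_def by (intro emeasure_mono) auto

lemma line_len_shift:
  assumes [measurable]: "A \<in> sets borel"
  shows "line_len u A (y + s *\<^sub>R u) = line_len u A y"
proof -
  have "line_len u A y = (\<integral>\<^sup>+t. indicator A (y + (s + 1 * t) *\<^sub>R u) \<partial>lborel)"
    unfolding line_len_eq_nn_integral[OF assms] by (subst nn_integral_real_affine[where c=1 and t=s]) auto
  then show ?thesis
    by (simp add: line_len_eq_nn_integral assms algebra_simps)
qed

lemma nn_integral_lborel_translate: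
  fixes f :: "'a::euclidean_space \<Rightarrow> ennreal"
  assumes [measurable]: "f \<in> borel_measurable borel"
  shows "(\<integral>\<^sup>+x. f (x + c) \<partial>lborel) = (\<integral>\<^sup>+x. f x \<partial>lborel)"
proof -
  have "(\<integral>\<^sup>+x. f x \<partial>lborel) = (\<integral>\<^sup>+x. f x \<partial>distr lborel borel ((+) c))"
    by (simp add: lborel_distr_plus)
  then show ?thesis
    by (simp add: nn_integral_distr add.commute)
qed

lemma line_len_slab:
  fixes u :: "'a::euclidean_space"
  assumes u: "norm u = 1"
  shows "line_len u (slab u) y = 1"
proof -
  have "u \<bullet> u = 1" using u by (simp add: dot_square_norm)
  then have "{t. y + t *\<^sub>R u \<in> slab u} = {- (y \<bullet> u) ..< 1 - y \<bullet> u}"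
    by (auto simp: slab_def inner_add_left)
  then show ?thesis by (simp add: line_len_def)
qed

text \<open>The slab meets every line parallel to \<open>u\<close> in a set of length 1, so integration over the slab
  followed by integration along the lines is Fubini's theorem for \<open>u\<^sup>\<bottom> \<times> \<real>\<close>, obtained from translation
  invariance alone.\<close>

lemma nn_integral_lines:
  fixes f :: "'a::euclidean_space \<Rightarrow> ennreal"
  assumes [measurable]: "f \<in> borel_measurable borel" and u: "norm u = 1"
  shows "(\<integral>\<^sup>+x. f x \<partial>lborel)
       = (\<integral>\<^sup>+y. indicator (slab u) y * (\<integral>\<^sup>+t. f (y + t *\<^sub>R u) \<partial>lborel) \<partial>lborel)"
proof -
  have "(\<integral>\<^sup>+y. indicator (slab u) y * (\<integral>\<^sup>+t. f (y + t *\<^sub>R u) \<partial>lborel) \<partial>lborel)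
      = (\<integral>\<^sup>+y. \<integral>\<^sup>+t. indicator (slab u) y * f (y + t *\<^sub>R u) \<partial>lborel \<partial>lborel)"
    by (intro nn_integral_cong) (simp add: nn_integral_cmult)
  also have "\<dots> = (\<integral>\<^sup>+t. \<integral>\<^sup>+y. indicator (slab u) y * f (y + t *\<^sub>R u) \<partial>lborel \<partial>lborel)"
    by (intro lborel_pair.Fubini') measurable
  also have "\<dots> = (\<integral>\<^sup>+t. \<integral>\<^sup>+y. indicator (slab u) (y - t *\<^sub>R u) * f y \<partial>lborel \<partial>lborel)"
  proof (rule nn_integral_cong)
    fix t :: real
    show "(\<integral>\<^sup>+y. indicator (slab u) y * f (y + t *\<^sub>R u) \<partial>lborel)
        = (\<integral>\<^sup>+y. indicator (slab u) (y - t *\<^sub>R u) * f y \<partial>lborel)"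
      by (subst nn_integral_lborel_translate[of "\<lambda>y. indicator (slab u) (y - t *\<^sub>R u) * f y" "t *\<^sub>R u", symmetric])
         simp_all
  qed
  also have "\<dots> = (\<integral>\<^sup>+y. \<integral>\<^sup>+t. indicator (slab u) (y - t *\<^sub>R u) * f y \<partial>lborel \<partial>lborel)"
    by (intro lborel_pair.Fubini') measurable
  \<comment> \<open>The inner integral is the length that the reversed line through \<open>y\<close>
    has in the slab, which is 1, so \<open>f y\<close> keeps its weight.\<close>
  also have "\<dots> = (\<integral>\<^sup>+y. line_len (- u) (slab u) y * f y \<partial>lborel)"
    by (intro nn_integral_cong) (simp add: line_len_eq_nn_integral nn_integral_multc)
  also have "\<dots> = (\<integral>\<^sup>+y. f y \<partial>lborel)"
  proof (rule nn_integral_cong)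
    fix y :: 'a
    have "line_len (- u) (slab u) y = (\<integral>\<^sup>+t. indicator (slab u) (y + t *\<^sub>R u) \<partial>lborel)"
      by (subst nn_integral_real_affine[where c="-1" and t=0]) (simp_all add: line_len_eq_nn_integral)
    also have "\<dots> = 1"
      using line_len_slab[OF u, of y] by (simp add: line_len_eq_nn_integral)
    finally show "line_len (- u) (slab u) y * f y = f y" by simp
  qed
  finally show ?thesis ..
qed

lemma emeasure_lines:
  fixes A :: "'a::euclidean_space set"
  assumes A[measurable]: "A \<in> sets borel" and u: "norm u = 1"
  shows "emeasure lborel A = (\<integral>\<^sup>+y. indicator (slab u) y * line_len u A y \<partial>lborel)"
proof -
  have "emeasure lborel A = (\<integral>\<^sup>+x. indicator A x \<partial>lborel)" by simp
  then show ?thesis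
    by (subst (asm) nn_integral_lines[OF _ u]) (simp_all add: line_len_eq_nn_integral)
qed

text \<open>The sets \<open>A w\<close> will be random. Joint measurability of membership in
  parameter and point lets the integral over \<open>t\<close> stay measurable in both
  variables.\<close>

lemma line_len_family_measurable:
  fixes s :: "'w \<Rightarrow> 'a::euclidean_space"
  assumes [measurable]: "Measurable.pred (M \<Otimes>\<^sub>M borel) (\<lambda>p. snd p \<in> A (fst p))"
    and [measurable]: "s \<in> borel_measurable M"
  shows "(\<lambda>p. line_len (s (fst p)) (A (fst p)) (snd p)) \<in> borel_measurable (M \<Otimes>\<^sub>M borel)"
proof -
  have "(\<lambda>p. \<integral>\<^sup>+t. indicator {x. snd x \<in> A (fst x)} (fst p, snd p + t *\<^sub>R s (fst p)) \<partial>lborel)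
      \<in> borel_measurable (M \<Otimes>\<^sub>M borel)"
  proof (rule lborel.borel_measurable_nn_integral)
    have "(\<lambda>q. indicator {x. snd x \<in> A (fst x)} (fst (fst q), snd (fst q) + snd q *\<^sub>R s (fst (fst q))) :: ennreal)
       = (\<lambda>q. if snd (fst (fst q), snd (fst q) + snd q *\<^sub>R s (fst (fst q)))
             \<in> A (fst (fst (fst q), snd (fst q) + snd q *\<^sub>R s (fst (fst q)))) then 1 else 0)"
      by (auto simp: fun_eq_iff indicator_def)
    moreover have "Measurable.pred ((M \<Otimes>\<^sub>M borel) \<Otimes>\<^sub>M lborel)
       (\<lambda>q. snd (fst (fst q), snd (fst q) + snd q *\<^sub>R s (fst (fst q)))
             \<in> A (fst (fst (fst q), snd (fst q) + snd q *\<^sub>R s (fst (fst q)))))"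
      by (rule measurable_compose[OF _ assms(1)]) measurable
    ultimately show "(\<lambda>(p, t). indicator {x. snd x \<in> A (fst x)} (fst p, snd p + t *\<^sub>R s (fst p)) :: ennreal)
       \<in> borel_measurable ((M \<Otimes>\<^sub>M borel) \<Otimes>\<^sub>M lborel)"
      by (simp add: split_beta')
  qed
  moreover have "(\<integral>\<^sup>+t. indicator {x. snd x \<in> A (fst x)} (fst p, snd p + t *\<^sub>R s (fst p)) \<partial>lborel)
     = line_len (s (fst p)) (A (fst p)) (snd p)" if "p \<in> space (M \<Otimes>\<^sub>M borel)" for p
  proof -
    have "{z. snd (fst p, z) \<in> A (fst (fst p, z))} \<in> sets borel"
      using measurable_compose[OF measurable_Pair1' assms(1), of "fst p"] that
      by (auto simp: pred_def space_pair_measure)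
    then have "A (fst p) \<in> sets borel" by simp
    then show ?thesis
      by (simp add: line_len_eq_nn_integral indicator_def)
  qed
  ultimately show ?thesis
    by (simp cong: measurable_cong)
qed

text \<open>Hypothesis and conclusion have the same form, so joint measurability passes through any
  number of random symmetrizations.\<close>

lemma open_symmetral_family_measurable:
  fixes s :: "'w \<Rightarrow> 'a::euclidean_space"
  assumes "Measurable.pred (M \<Otimes>\<^sub>M borel) (\<lambda>p. snd p \<in> A (fst p))"
    and [measurable]: "s \<in> borel_measurable M"
  shows "Measurable.pred (M \<Otimes>\<^sub>M borel) (\<lambda>p. snd p \<in> open_symmetral (s (fst p)) (A (fst p)))"
proof -
  note line_len_family_measurable[OF assms, measurable]
  show ?thesis unfolding open_symmetral_def mem_Collect_eq by measurable
qed

lemma line_len_measurable [measurable]: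
  fixes A :: "'a::euclidean_space set"
  assumes [measurable]: "A \<in> sets borel"
  shows "line_len u A \<in> borel_measurable borel"
proof -
  have "(\<lambda>y. \<integral>\<^sup>+t. indicator A (y + t *\<^sub>R u) \<partial>lborel) \<in> borel_measurable borel" by measurable
  then show ?thesis by (simp add: line_len_eq_nn_integral[symmetric])
qed

lemma open_symmetral_borel [measurable]:
  fixes A :: "'a::euclidean_space set"
  assumes [measurable]: "A \<in> sets borel"
  shows "open_symmetral u A \<in> sets borel"
  unfolding open_symmetral_def by measurable

text \<open>The length is constant along the line, so membership depends on \<open>t\<close> only
  through its distance from \<open>- (y \<bullet> u)\<close>, the parameter at which the line
  crosses the hyperplane orthogonal to \<open>u\<close>.\<close>

lemma open_symmetral_section:
  assumes "A \<in> sets borel" and u: "norm u = 1"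
  shows "{t. y + t *\<^sub>R u \<in> open_symmetral u A} = {t. ennreal (2 * \<bar>y \<bullet> u + t\<bar>) < line_len u A y}"
proof -
  have "u \<bullet> u = 1" using u by (simp add: dot_square_norm)
  then show ?thesis
    using assms by (simp add: open_symmetral_def inner_add_left line_len_shift)
qed

lemma centered_interval: "{t::real. 2 * \<bar>c + t\<bar> < l} = {- c - l / 2 <..< - c + l / 2}"
  by (auto simp: abs_real_def split: if_splits)

lemma line_len_open_symmetral:
  assumes A: "A \<in> sets borel" and u: "norm u = 1"
  shows "line_len u (open_symmetral u A) y = line_len u A y"
proof (cases "line_len u A y")
  case (real l)
  then have "{t. y + t *\<^sub>R u \<in> open_symmetral u A} = {t. 2 * \<bar>y \<bullet> u + t\<bar> < l}"
    unfolding open_symmetral_section[OF assms] by (auto simp: ennreal_less_iff)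
  then have "line_len u (open_symmetral u A) y = ennreal l"
    using real unfolding line_len_def centered_interval by simp
  then show ?thesis using real by simp
next
  case top
  then have "{t. y + t *\<^sub>R u \<in> open_symmetral u A} = UNIV"
    unfolding open_symmetral_section[OF assms] by auto
  then show ?thesis using top unfolding line_len_def[of u "open_symmetral u A"] by simp
qed

text \<open>Cavalieri's principle: the lengths agree on every line.\<close>

lemma emeasure_open_symmetral:
  fixes A :: "'a::euclidean_space set"
  assumes [measurable]: "A \<in> sets borel" and u: "norm u = 1"
  shows "emeasure lborel (open_symmetral u A) = emeasure lborel A"
  using assms by (simp add: emeasure_lines line_len_open_symmetral)

subsection \<open>Symmetrization and concentric balls\<close>

text \<open>Pythagoras: \<open>(norm y)\<^sup>2 - (y \<bullet> u)\<^sup>2\<close> is the squared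
  distance of the line from the origin.\<close>

lemma norm_line_point:
  fixes u y :: "'a::euclidean_space"
  assumes "norm u = 1"
  shows "(norm (y + t *\<^sub>R u))\<^sup>2 = (norm y)\<^sup>2 - (y \<bullet> u)\<^sup>2 + (y \<bullet> u + t)\<^sup>2"
proof -
  have "u \<bullet> u = 1" using assms by (simp add: dot_square_norm)
  then show ?thesis
    unfolding power2_norm_eq_inner by (simp add: power2_eq_square inner_add_left inner_add_right inner_commute[of u y] algebra_simps)
qed

text \<open>The section is a segment with the same centre as that of the symmetral. An empty section
  is recorded by a negative half-length, so that one formula serves all lines.\<close>

lemma cball_section:
  fixes u y :: "'a::euclidean_space"
  assumes u: "norm u = 1"
  obtains \<gamma> where "{t. y + t *\<^sub>R u \<in> cball 0 R} = {t. \<bar>y \<bullet> u + t\<bar> \<le> \<gamma>}" and "\<gamma> \<le> R \<or> \<gamma> < 0"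
proof (cases "R \<ge> 0 \<and> R\<^sup>2 - ((norm y)\<^sup>2 - (y \<bullet> u)\<^sup>2) \<ge> 0")
  case True
  have "(y \<bullet> u)\<^sup>2 \<le> (norm y)\<^sup>2"
    using Cauchy_Schwarz_ineq2[of y u] u by (simp add: abs_le_square_iff[symmetric])
  then have g: "sqrt (R\<^sup>2 - ((norm y)\<^sup>2 - (y \<bullet> u)\<^sup>2)) \<le> R"
    using True by (intro real_le_lsqrt) auto
  have "y + t *\<^sub>R u \<in> cball 0 R \<longleftrightarrow> \<bar>y \<bullet> u + t\<bar> \<le> sqrt (R\<^sup>2 - ((norm y)\<^sup>2 - (y \<bullet> u)\<^sup>2))" for t
  proof -
    have "y + t *\<^sub>R u \<in> cball 0 R \<longleftrightarrow> (norm (y + t *\<^sub>R u))\<^sup>2 \<le> R\<^sup>2"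
      using True by (simp add: abs_le_square_iff[symmetric])
    also have "\<dots> \<longleftrightarrow> \<bar>y \<bullet> u + t\<bar>\<^sup>2 \<le> (sqrt (R\<^sup>2 - ((norm y)\<^sup>2 - (y \<bullet> u)\<^sup>2)))\<^sup>2"
      using True by (simp add: norm_line_point[OF u]) linarith
    also have "\<dots> \<longleftrightarrow> \<bar>y \<bullet> u + t\<bar> \<le> sqrt (R\<^sup>2 - ((norm y)\<^sup>2 - (y \<bullet> u)\<^sup>2))"
      using True by (intro power_mono_iff) auto
    finally show ?thesis .
  qed
  with g that show ?thesis by blast
next
  case False
  have "y + t *\<^sub>R u \<notin> cball 0 R" for t
  proof
    assume a: "y + t *\<^sub>R u \<in> cball 0 R"
    then have "0 \<le> R" using norm_ge_zero[of "y + t *\<^sub>R u"] by (simp del: norm_ge_zero)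
    moreover from a this have "(norm (y + t *\<^sub>R u))\<^sup>2 \<le> R\<^sup>2" by (simp add: abs_le_square_iff[symmetric])
    moreover have "(0::real) \<le> (y \<bullet> u + t)\<^sup>2" by simp
    ultimately show False using False unfolding norm_line_point[OF u] by linarith
  qed
  then have "{t. y + t *\<^sub>R u \<in> cball 0 R} = {t. \<bar>y \<bullet> u + t\<bar> \<le> -1}" by auto
  with that[of "-1"] show ?thesis by simp
qed

lemma line_len_cball:
  fixes u :: "'a::euclidean_space"
  assumes u: "norm u = 1" and R: "0 \<le> R"
  shows "line_len u (cball 0 R) y \<le> ennreal (2 * R)"
proof -
  obtain \<gamma> where g: "{t. y + t *\<^sub>R u \<in> cball 0 R} = {t. \<bar>y \<bullet> u + t\<bar> \<le> \<gamma>}" "\<gamma> \<le> R \<or> \<gamma> < 0"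
    using cball_section[OF u] by metis
  have "line_len u (cball 0 R) y \<le> emeasure lborel {- (y \<bullet> u) - R .. - (y \<bullet> u) + R}"
    unfolding line_len_def g(1) using g(2) R by (intro emeasure_mono) auto
  then show ?thesis using R by simp
qed

text \<open>If \<open>z\<close> lies outside the ball, every point of \<open>A\<close> on its line
  is nearer to the midpoint than \<open>z\<close>. Such points fill a length of at most
  \<open>2 * \<bar>z \<bullet> u\<bar>\<close>, against the strict inequality that defines the open
  symmetral.\<close>

lemma open_symmetral_subset_cball:
  fixes A :: "'a::euclidean_space set"
  assumes A: "A \<subseteq> cball 0 R" and u: "norm u = 1"
  shows "open_symmetral u A \<subseteq> cball 0 R"
proof (rule subsetI, rule ccontr)
  fix z assume z: "z \<in> open_symmetral u A" and "z \<notin> cball 0 R"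
  then have R: "R < norm z" by simp
  have "\<bar>z \<bullet> u + t\<bar> < \<bar>z \<bullet> u\<bar>" if "z + t *\<^sub>R u \<in> A" for t
  proof (rule ccontr)
    assume "\<not> \<bar>z \<bullet> u + t\<bar> < \<bar>z \<bullet> u\<bar>"
    then have "(z \<bullet> u)\<^sup>2 \<le> (z \<bullet> u + t)\<^sup>2" by (simp add: abs_le_square_iff[symmetric])
    then have "(norm z)\<^sup>2 \<le> (norm (z + t *\<^sub>R u))\<^sup>2" by (simp add: norm_line_point[OF u])
    then have "norm z \<le> norm (z + t *\<^sub>R u)" by (simp add: abs_le_square_iff[symmetric])
    with R A that show False by fastforce
  qed
  then have "{t. z + t *\<^sub>R u \<in> A} \<subseteq> {t. 2 * \<bar>z \<bullet> u + t\<bar> < 2 * \<bar>z \<bullet> u\<bar>}" by auto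
  then have "line_len u A z \<le> emeasure lborel {t. 2 * \<bar>z \<bullet> u + t\<bar> < 2 * \<bar>z \<bullet> u\<bar>}"
    unfolding line_len_def by (intro emeasure_mono) (auto simp: centered_interval)
  also have "\<dots> = ennreal (2 * \<bar>z \<bullet> u\<bar>)" unfolding centered_interval by simp
  finally show False using z by (simp add: open_symmetral_def)
qed

lemma sym_diff_nested:
  assumes [measurable]: "I \<in> sets M" "J \<in> sets M" and "I \<subseteq> J"
  shows "emeasure M I + emeasure M (sym_diff I J) = emeasure M J"
proof -
  have "sym_diff I J = J - I" "I \<union> (J - I) = J" using assms by auto
  then show ?thesis using plus_emeasure[of I M "J - I"] by simp
qed

text \<open>The two concentric segments are nested, so their symmetric difference has length |a -
  b|, and (a + b) - |a - b| = 2 min a b. The additive form avoids subtraction of extended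
  reals.\<close>

lemma line_len_sym_diff_symmetral:
  fixes A :: "'a::euclidean_space set"
  assumes A[measurable]: "A \<in> sets borel" and AR: "A \<subseteq> cball 0 R" and R: "0 \<le> R" "r \<le> R" and u: "norm u = 1"
  defines "B \<equiv> cball 0 r"
  shows "line_len u (sym_diff (open_symmetral u A) B) y
     + 2 * min (line_len u (A - B) y) (line_len u (B - A) y) = line_len u (sym_diff A B) y"
proof -
  let ?S = "\<lambda>E. {t. y + t *\<^sub>R u \<in> E}"
  let ?I = "?S (open_symmetral u A)"
  have B[measurable]: "B \<in> sets borel" by (simp add: B_def)
  have BR: "B \<subseteq> cball 0 R" using R by (simp add: B_def subset_cball)
  have fin: "line_len u E y < \<infinity>" if "E \<subseteq> cball 0 R" for E
    using line_len_mono[OF that, of u y] line_len_cball[OF u R(1), of y]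
    by (simp add: le_less_trans)
  have IJ[measurable]: "?I \<in> sets borel" "?S B \<in> sets borel" by measurable
  obtain \<gamma> where g: "?S B = {t. \<bar>y \<bullet> u + t\<bar> \<le> \<gamma>}"
    using cball_section[OF u] unfolding B_def by metis
  have add: "line_len u (E \<union> G) y = line_len u E y + line_len u G y"
    if "E \<inter> G = {}" "E \<in> sets borel" "G \<in> sets borel" for E G
  proof -
    have "?S (E \<union> G) = ?S E \<union> ?S G" "?S E \<inter> ?S G = {}" using that by auto
    then show ?thesis
      unfolding line_len_def using that by (simp add: plus_emeasure)
  qed
  \<comment> \<open>If \<open>\<gamma>\<close> is negative, \<open>ennreal (2 * \<gamma>)\<close> is
    0 and the section of \<open>B\<close> is empty; both branches remain valid.\<close>
  have nest: "?I \<subseteq> ?S B \<or> ?S B \<subseteq> ?I"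
  proof (cases "ennreal (2 * \<gamma>) < line_len u A y")
    case True
    have "?S B \<subseteq> ?I"
    proof
      fix t assume "t \<in> ?S B"
      then have "\<bar>y \<bullet> u + t\<bar> \<le> \<gamma>" using g by blast
      then have "ennreal (2 * \<bar>y \<bullet> u + t\<bar>) \<le> ennreal (2 * \<gamma>)" by (intro ennreal_leI) simp
      with True show "t \<in> ?I" unfolding open_symmetral_section[OF A u] by simp
    qed
    then show ?thesis by simp
  next
    case False
    have "?I \<subseteq> ?S B"
    proof
      fix t assume "t \<in> ?I"
      then have "ennreal (2 * \<bar>y \<bullet> u + t\<bar>) < ennreal (2 * \<gamma>)"
        using False unfolding open_symmetral_section[OF A u] by simp
      then show "t \<in> ?S B" unfolding g by (simp add: ennreal_less_iff)
    qed
    then show ?thesis by simp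
  qed
  have I: "emeasure lborel ?I = line_len u A y"
    using line_len_open_symmetral[OF A u] by (simp add: line_len_def)
  have sd: "line_len u (sym_diff (open_symmetral u A) B) y = emeasure lborel (sym_diff ?I (?S B))"
    unfolding line_len_def by (intro arg_cong[where f="emeasure lborel"]) auto
  have eqs: "line_len u A y = line_len u (A - B) y + line_len u (A \<inter> B) y"
    "line_len u B y = line_len u (B - A) y + line_len u (A \<inter> B) y"
    "line_len u (sym_diff A B) y = line_len u (A - B) y + line_len u (B - A) y"
  proof -
    have "(A - B) \<union> (A \<inter> B) = A" "(B - A) \<union> (A \<inter> B) = B"
      "(A - B) \<inter> (A \<inter> B) = {}" "(B - A) \<inter> (A \<inter> B) = {}" "(A - B) \<inter> (B - A) = {}" by auto
    then show "line_len u A y = line_len u (A - B) y + line_len u (A \<inter> B) y"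
      "line_len u B y = line_len u (B - A) y + line_len u (A \<inter> B) y"
      "line_len u (sym_diff A B) y = line_len u (A - B) y + line_len u (B - A) y"
      using add[of "A - B" "A \<inter> B"] add[of "B - A" "A \<inter> B"] add[of "A - B" "B - A"] by simp_all
  qed
  obtain a where a: "line_len u (A - B) y = ennreal a" "0 \<le> a"
    using fin[of "A - B"] AR by (metis Diff_subset ennreal_cases order.trans less_irrefl infinity_ennreal_def)
  obtain b where b: "line_len u (B - A) y = ennreal b" "0 \<le> b"
    using fin[of "B - A"] BR by (metis Diff_subset ennreal_cases order.trans less_irrefl infinity_ennreal_def)
  obtain c where c: "line_len u (A \<inter> B) y = ennreal c" "0 \<le> c"
    using fin[of "A \<inter> B"] AR by (metis Int_lower1 ennreal_cases order.trans less_irrefl infinity_ennreal_def)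
  obtain d where d: "line_len u (sym_diff (open_symmetral u A) B) y = ennreal d" "0 \<le> d"
    using fin[of "sym_diff (open_symmetral u A) B"] open_symmetral_subset_cball[OF AR u] BR
    by (metis Diff_subset Un_least ennreal_cases order.trans less_irrefl infinity_ennreal_def)
  \<comment> \<open>All lengths are finite inside \<open>cball 0 R\<close>, so \<open>c\<close> can
    be cancelled; this leaves \<open>d\<close> as the difference of \<open>a\<close> and
    \<open>b\<close> in one order or the other.\<close>
  have "(a + c) + d = b + c \<or> (b + c) + d = a + c"
    using nest
  proof
    assume "?I \<subseteq> ?S B"
    from sym_diff_nested[OF _ _ this, of lborel] have "line_len u A y + ennreal d = line_len u B y"
      using d sd I by (simp add: line_len_def)
    then show ?thesis using eqs a b c d by (simp flip: ennreal_plus)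
  next
    assume "?S B \<subseteq> ?I"
    from sym_diff_nested[OF _ _ this, of lborel] have "line_len u B y + ennreal d = line_len u A y"
      using d sd I by (simp add: line_len_def Un_commute)
    then show ?thesis using eqs a b c d by (simp flip: ennreal_plus)
  qed
  then have "d + 2 * min a b = a + b" using d(2) by (auto simp: min_def)
  moreover have "2 * min (ennreal a) (ennreal b) = ennreal (2 * min a b)"
    using a b by (simp add: ennreal_mult min_def ennreal_le_iff)
  ultimately show ?thesis
    unfolding eqs(3) a(1) b(1) d(1) using a b d by (simp flip: ennreal_plus)
qed

text \<open>On each line a and b are at most \<open>2 * R\<close>, hence a b is at most R times the
  gain 2 min a b. Integrated over the slab, the product becomes an integral over
  \<open>A - B\<close> because the length of \<open>B - A\<close> is constant along each
  line.\<close>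

lemma emeasure_sym_diff_symmetral:
  fixes A :: "'a::euclidean_space set"
  assumes A[measurable]: "A \<in> sets borel" and AR: "A \<subseteq> cball 0 R" and R: "0 \<le> R" "r \<le> R" and u: "norm u = 1"
  defines "B \<equiv> cball 0 r"
  shows "ennreal R * emeasure lborel (sym_diff (open_symmetral u A) B)
     + (\<integral>\<^sup>+p. indicator (A - B) p * line_len u (B - A) p \<partial>lborel) \<le> ennreal R * emeasure lborel (sym_diff A B)"
proof -
  have B[measurable]: "B \<in> sets borel" by (simp add: B_def)
  have BR: "B \<subseteq> cball 0 R" using R by (simp add: B_def subset_cball)
  let ?a = "line_len u (A - B)" and ?b = "line_len u (B - A)"
  have len: "line_len u E y \<le> ennreal (2 * R)" if "E \<subseteq> cball 0 R" for E y
    using line_len_mono[OF that, of u y] line_len_cball[OF u R(1), of y] by simp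
  have ab: "?a y * ?b y \<le> ennreal R * (2 * min (?a y) (?b y))" for y
  proof -
    have "?a y * ?b y \<le> ennreal (2 * R) * min (?a y) (?b y)"
    proof (cases "?a y \<le> ?b y")
      case True
      have "?a y * ?b y \<le> ?a y * ennreal (2 * R)"
        using len[of "B - A" y] BR by (intro mult_left_mono) auto
      with True show ?thesis by (simp add: min_def mult.commute)
    next
      case False
      have "?a y * ?b y \<le> ennreal (2 * R) * ?b y"
        using len[of "A - B" y] AR by (intro mult_right_mono) auto
      with False show ?thesis by (simp add: min_def)
    qed
    also have "\<dots> = ennreal R * (2 * min (?a y) (?b y))"
      using R by (simp add: ennreal_mult mult_ac)
    finally show ?thesis .
  qed
  have "(\<integral>\<^sup>+p. indicator (A - B) p * ?b p \<partial>lborel)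
      = (\<integral>\<^sup>+y. indicator (slab u) y * (?a y * ?b y) \<partial>lborel)"
    by (subst nn_integral_lines[OF _ u])
       (auto simp: line_len_shift nn_integral_multc line_len_eq_nn_integral[of "A - B"])
  then have "ennreal R * emeasure lborel (sym_diff (open_symmetral u A) B)
       + (\<integral>\<^sup>+p. indicator (A - B) p * ?b p \<partial>lborel)
     = (\<integral>\<^sup>+y. ennreal R * (indicator (slab u) y * line_len u (sym_diff (open_symmetral u A) B) y)
          + indicator (slab u) y * (?a y * ?b y) \<partial>lborel)"
    by (subst nn_integral_add) (auto simp: nn_integral_cmult emeasure_lines[OF _ u])
  also have "\<dots> \<le> (\<integral>\<^sup>+y. ennreal R * (indicator (slab u) y * line_len u (sym_diff A B) y) \<partial>lborel)"
  proof (rule nn_integral_mono)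
    fix y :: 'a
    have "ennreal R * line_len u (sym_diff (open_symmetral u A) B) y + ?a y * ?b y
       \<le> ennreal R * line_len u (sym_diff (open_symmetral u A) B) y + ennreal R * (2 * min (?a y) (?b y))"
      using ab by (intro add_left_mono)
    also have "\<dots> = ennreal R * line_len u (sym_diff A B) y"
      using line_len_sym_diff_symmetral[OF A AR R u, of y] unfolding B_def
      by (simp add: distrib_left[symmetric])
    finally show "ennreal R * (indicator (slab u) y * line_len u (sym_diff (open_symmetral u A) B) y)
          + indicator (slab u) y * (?a y * ?b y)
        \<le> ennreal R * (indicator (slab u) y * line_len u (sym_diff A B) y)"
      by (auto split: split_indicator)
  qed
  also have "\<dots> = ennreal R * emeasure lborel (sym_diff A B)"
    by (simp add: nn_integral_cmult emeasure_lines[OF _ u])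
  finally show ?thesis .
qed

section \<open>Null sets: the Steiner symmetral compared with its Borel substitute\<close>

lemma emeasure_lebesgue_cong_null:
  assumes A': "A' \<in> sets borel" and N: "N \<in> null_sets lborel" and sub: "sym_diff A A' \<subseteq> N"
  shows "A \<in> sets lebesgue" and "emeasure lebesgue A = emeasure lborel A'"
proof -
  have n: "A - A' \<in> null_sets lebesgue" "A' - A \<in> null_sets lebesgue"
    using N sub by (auto simp: null_sets_completion_iff2)
  have A: "A = (A' - (A' - A)) \<union> (A - A')" by auto
  have A'l: "A' \<in> sets lebesgue" using A' by simp
  show "A \<in> sets lebesgue"
    by (subst A) (intro sets.Un sets.Diff A'l null_setsD2 n)
  have "emeasure lebesgue A = emeasure lebesgue (A' - (A' - A))"
    by (subst A) (intro emeasure_Un_null_set sets.Diff A'l null_setsD2 n)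
  also have "\<dots> = emeasure lebesgue A'"
    by (intro emeasure_Diff_null_set n A'l)
  finally show "emeasure lebesgue A = emeasure lborel A'" using A' by simp
qed

text \<open>The foot \<open>x\<close> of the perpendicular from \<open>z\<close> is the only point
  of the hyperplane whose line contains \<open>z\<close>. The existence clause records that a line
  missing \<open>A\<close> contributes nothing, not even a degenerate midpoint.\<close>

lemma steiner_symmetral_iff:
  fixes z :: "'a::euclidean_space"
  assumes u: "norm u = 1"
  defines "x \<equiv> z - (z \<bullet> u) *\<^sub>R u"
  shows "z \<in> steiner_symmetral u A \<longleftrightarrow> (\<exists>t. x + t *\<^sub>R u \<in> A) \<and> ennreal (2 * \<bar>z \<bullet> u\<bar>) \<le> line_outer_measure u x A"
    (is "?l \<longleftrightarrow> ?r")
proof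
  have uu: "u \<bullet> u = 1" using u by (simp add: dot_square_norm)
  {
    assume ?l
    then obtain x' where x': "x' \<bullet> u = 0" "z \<in> steiner_segment u A x'"
      by (auto simp: steiner_symmetral_def)
    then obtain t where ne: "A \<inter> line_through u x' \<noteq> {}"
      and t: "z = x' + t *\<^sub>R u" "ennreal (2 * \<bar>t\<bar>) \<le> line_outer_measure u x' A"
      by (auto simp: steiner_segment_def split: if_splits)
    have zt: "z \<bullet> u = t" using t x' uu by (simp add: inner_add_left)
    then have "x = x'" using t by (simp add: x_def)
    with ne t zt show ?r by (auto simp: line_through_def)
  next
    assume r: ?r
    have x0: "x \<bullet> u = 0" using uu by (simp add: x_def inner_diff_left)
    have "A \<inter> line_through u x \<noteq> {}" using r by (auto simp: line_through_def)
    moreover have "z = x + (z \<bullet> u) *\<^sub>R u" by (simp add: x_def)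
    ultimately have "z \<in> steiner_segment u A x"
      using r unfolding steiner_segment_def by auto
    with x0 show ?l by (auto simp: steiner_symmetral_def)
  }
qed

text \<open>By Fubini, the integral of the line lengths is an integral over \<open>t\<close> of the
  volumes of translates of \<open>N\<close>, all of which vanish.\<close>

lemma AE_line_len_null:
  fixes N :: "'a::euclidean_space set"
  assumes N: "N \<in> null_sets lborel"
  shows "AE y in lborel. line_len u N y = 0"
proof -
  have [measurable]: "N \<in> sets borel" using N by auto
  have "(\<integral>\<^sup>+y. line_len u N y \<partial>lborel) = (\<integral>\<^sup>+y. \<integral>\<^sup>+t. indicator N (y + t *\<^sub>R u) \<partial>lborel \<partial>lborel)"
    by (simp add: line_len_eq_nn_integral)
  also have "\<dots> = (\<integral>\<^sup>+t. \<integral>\<^sup>+y. indicator N (y + t *\<^sub>R u) \<partial>lborel \<partial>lborel)"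
    by (intro lborel_pair.Fubini') measurable
  also have "\<dots> = (\<integral>\<^sup>+t. 0 \<partial>(lborel::real measure))"
    using N by (intro nn_integral_cong) (simp add: nn_integral_lborel_translate[of "indicator N"] null_setsD1)
  finally show ?thesis using nn_integral_0_iff_AE[of "line_len u N" lborel] by simp
qed

text \<open>These points are the possible endpoints of the closed segments: at most two on each
  line, none if the length is infinite.\<close>

lemma symmetral_boundary_null:
  fixes A :: "'a::euclidean_space set"
  assumes [measurable]: "A \<in> sets borel" and u: "norm u = 1"
  shows "{z. ennreal (2 * \<bar>z \<bullet> u\<bar>) = line_len u A z} \<in> null_sets lborel"
proof -
  let ?E = "{z. ennreal (2 * \<bar>z \<bullet> u\<bar>) = line_len u A z}"
  have [measurable]: "?E \<in> sets borel" by measurable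
  have uu: "u \<bullet> u = 1" using u by (simp add: dot_square_norm)
  have "line_len u ?E y = 0" for y
  proof -
    have sec: "{t. y + t *\<^sub>R u \<in> ?E} = {t. ennreal (2 * \<bar>y \<bullet> u + t\<bar>) = line_len u A y}"
      using uu by (simp add: inner_add_left line_len_shift assms)
    have "{t. y + t *\<^sub>R u \<in> ?E} \<subseteq> {enn2real (line_len u A y) / 2 - y \<bullet> u, - enn2real (line_len u A y) / 2 - y \<bullet> u}"
    proof
      fix t assume "t \<in> {t. y + t *\<^sub>R u \<in> ?E}"
      then have "enn2real (ennreal (2 * \<bar>y \<bullet> u + t\<bar>)) = enn2real (line_len u A y)"
        unfolding sec by simp
      then show "t \<in> {enn2real (line_len u A y) / 2 - y \<bullet> u, - enn2real (line_len u A y) / 2 - y \<bullet> u}"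
        by (auto simp: abs_real_def split: if_splits)
    qed
    then show ?thesis
      unfolding line_len_def by (intro emeasure_lborel_countable) (meson countable_finite finite.intros countable_subset)
  qed
  then show ?thesis by (auto simp: null_sets_def emeasure_lines[OF _ u])
qed

text \<open>Two null sets are discarded: the endpoints, where closed and open segments differ, and
  the union of the lines on which \<open>N\<close> has positive length. Elsewhere both symmetrals
  use the same length.\<close>

lemma steiner_symmetral_cong_null:
  fixes A :: "'a::euclidean_space set"
  assumes A': "A' \<in> sets borel" and N: "N \<in> null_sets lborel" and sub: "sym_diff A A' \<subseteq> N" and u: "norm u = 1"
  shows "\<exists>N'\<in>null_sets lborel. sym_diff (steiner_symmetral u A) (open_symmetral u A') \<subseteq> N'"
proof -
  have Nb[measurable]: "N \<in> sets borel" using N by auto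
  let ?E = "{z. ennreal (2 * \<bar>z \<bullet> u\<bar>) = line_len u A' z}" and ?Z = "{z. line_len u N z \<noteq> 0}"
  have "?Z \<in> null_sets lborel"
    using AE_line_len_null[OF N, of u] by (subst (asm) AE_iff_null) auto
  then have null: "?E \<union> ?Z \<in> null_sets lborel"
    using symmetral_boundary_null[OF A' u] by blast
  have "z \<in> steiner_symmetral u A \<longleftrightarrow> z \<in> open_symmetral u A'" if z: "z \<notin> ?E \<union> ?Z" for z
  proof -
    define x where "x = z - (z \<bullet> u) *\<^sub>R u"
    have zx: "z = x + (z \<bullet> u) *\<^sub>R u" by (simp add: x_def)
    have "line_len u N x = 0" using z line_len_shift[OF Nb, of u x "z \<bullet> u"] zx by simp
    then have Nx: "{t. x + t *\<^sub>R u \<in> N} \<in> null_sets lborel"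
      by (auto simp: line_len_def null_sets_def)
    have subx: "sym_diff {t. x + t *\<^sub>R u \<in> A} {t. x + t *\<^sub>R u \<in> A'} \<subseteq> {t. x + t *\<^sub>R u \<in> N}"
      using sub by auto
    \<comment> \<open>In dimension one this makes the section of \<open>A\<close> Lebesgue
      measurable, so that its outer measure is its length.\<close>
    note sec = emeasure_lebesgue_cong_null[OF line_section_borel[OF A'] Nx subx]
    have len: "line_outer_measure u x A = line_len u A' z"
      using sec line_len_shift[OF A', of u x "z \<bullet> u"] zx
      by (simp add: line_outer_measure_def line_len_def)
    show ?thesis
    proof
      assume "z \<in> steiner_symmetral u A"
      then show "z \<in> open_symmetral u A'"
        using z len by (auto simp: steiner_symmetral_iff[OF u] open_symmetral_def x_def[symmetric] less_le)
    next
      assume "z \<in> open_symmetral u A'"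
      then have lt: "ennreal (2 * \<bar>z \<bullet> u\<bar>) < line_outer_measure u x A"
        using len by (simp add: open_symmetral_def)
      \<comment> \<open>Positive outer measure forces the line to meet \<open>A\<close>.\<close>
      then have "{t. x + t *\<^sub>R u \<in> A} \<noteq> {}"
        unfolding line_outer_measure_def by (intro notI) simp
      with lt show "z \<in> steiner_symmetral u A"
        by (auto simp: steiner_symmetral_iff[OF u] x_def[symmetric])
    qed
  qed
  then have "sym_diff (steiner_symmetral u A) (open_symmetral u A') \<subseteq> ?E \<union> ?Z" by blast
  with null show ?thesis by blast
qed

subsection \<open>Averages over directions\<close>

text \<open>A lexicographic sign: when \<open>bs\<close> lists the basis, multiplication by it picks
  the same vector from \<open>u\<close> as from \<open>-u\<close>.\<close>

primrec leading_sign :: "'a::euclidean_space list \<Rightarrow> 'a \<Rightarrow> real" where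
  "leading_sign [] u = 1"
| "leading_sign (b # bs) u = (if u \<bullet> b > 0 then 1 else if u \<bullet> b < 0 then -1 else leading_sign bs u)"

lemma leading_sign_measurable [measurable]: "leading_sign bs \<in> borel_measurable borel"
proof (induction bs)
  case (Cons b bs)
  note Cons[measurable]
  have "(\<lambda>u. if u \<bullet> b > 0 then 1 else if u \<bullet> b < 0 then -1 else leading_sign bs u) \<in> borel_measurable borel"
    by measurable
  then show ?case by (simp cong: measurable_cong)
next
  case Nil
  have "leading_sign [] = (\<lambda>u::'a. 1)" by (auto simp: fun_eq_iff)
  then show ?case by simp
qed

lemma leading_sign_cases: "leading_sign bs u = 1 \<or> leading_sign bs u = -1"
  by (induction bs) auto

lemma leading_sign_minus: "\<exists>b\<in>set bs. u \<bullet> b \<noteq> 0 \<Longrightarrow> leading_sign bs (- u) = - leading_sign bs u"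
  by (induction bs) auto

text \<open>The \<open>\<sigma>\<close>-algebra of symmetric Borel sets does not separate \<open>u\<close> from \<open>-u\<close>; a measurable choice of
  one of the two makes the directions Borel measurable.\<close>

lemma direction_section:
  obtains s :: "'a::euclidean_space \<Rightarrow> 'a"
  where "s \<in> borel_measurable direction_measure" and "\<And>u. s u = u \<or> s u = - u"
proof -
  obtain bs :: "'a list" where bs: "set bs = Basis"
    using finite_list[OF finite_Basis] by blast
  define s where "s u = leading_sign bs u *\<^sub>R u" for u
  have s[measurable]: "s \<in> borel_measurable borel" unfolding s_def by measurable
  have cases: "s u = u \<or> s u = - u" for u
    using leading_sign_cases[of bs u] by (auto simp: s_def)
  \<comment> \<open>Evenness makes preimages under \<open>s\<close> symmetric, as the sigma-algebra
    of directions demands.\<close>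
  have even: "s (- u) = s u" for u
  proof (cases "u = 0")
    case False
    then have "\<exists>b\<in>set bs. u \<bullet> b \<noteq> 0"
      using bs euclidean_all_zero_iff[of u] by auto
    then show ?thesis by (simp add: s_def leading_sign_minus)
  qed simp
  have "s \<in> borel_measurable direction_measure"
  proof (rule measurableI)
    fix X :: "'a set" assume "X \<in> sets borel"
    then have "s -` X \<in> sets borel"
      using measurable_sets[OF s, of X] by simp
    moreover have "uminus ` (s -` X \<inter> sphere 0 1) = s -` X \<inter> sphere 0 1"
      using even by (force simp: image_iff intro: bexI[of _ "- _"])
    ultimately show "s -` X \<inter> space direction_measure \<in> sets direction_measure"
      by (auto simp: symmetric_borel_def)
  qed simp
  with cases that show ?thesis by blast
qed

section \<open>Polar coordinates and mean chord lengths\<close>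

lemma line_len_minus:
  assumes A: "A \<in> sets borel"
  shows "line_len (- u) A y = line_len u A y"
proof -
  have "(\<lambda>t. indicator A (y + t *\<^sub>R u) :: ennreal) \<in> borel_measurable borel"
    using A by measurable
  then show ?thesis
    using nn_integral_real_affine[of "\<lambda>t. indicator A (y + t *\<^sub>R u)" "-1" 0]
    by (simp add: line_len_eq_nn_integral A)
qed

text \<open>Surface area is defined by volumes of cones, and the cone over \<open>X\<close> is the
  preimage of \<open>X\<close> under radial projection within the punctured unit ball; the factor
  \<open>DIM('a)\<close> cancels. The vector \<open>b\<close> gives the projection a value on the
  sphere at the origin.\<close>

lemma direction_measure_eq_distr:
  fixes b :: "'a::euclidean_space"
  assumes b: "norm b = 1"
  defines "f \<equiv> \<lambda>y. if y = 0 then b else y /\<^sub>R norm y"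
  shows "f \<in> measurable borel direction_measure"
    and "direction_measure = distr (uniform_measure lborel (cball 0 1 - {0})) direction_measure f"
proof -
  have fb[measurable]: "f \<in> borel_measurable borel" unfolding f_def by measurable
  show fd: "f \<in> measurable borel direction_measure"
  proof (rule measurableI)
    fix X :: "'a set" assume "X \<in> sets direction_measure"
    then show "f -` X \<inter> space borel \<in> sets borel"
      using measurable_sets[OF fb, of X] by (simp add: symmetric_borel_def)
  qed (auto simp: f_def b)
  show "direction_measure = distr (uniform_measure lborel (cball 0 1 - {0})) direction_measure f"
  proof (rule measure_eqI)
    fix X :: "'a set" assume "X \<in> sets direction_measure"
    then have X: "X \<in> symmetric_borel" by simp
    then have Xs: "X \<subseteq> sphere 0 1" and Xb: "X \<in> sets borel" by (auto simp: symmetric_borel_def)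
    have Xf: "f -` X \<in> sets borel" using measurable_sets[OF fb Xb] by simp
    have cone: "(cball 0 1 - {0}) \<inter> f -` X = sphere_cone X"
      unfolding sphere_cone_eq[OF Xs] by (auto simp: f_def)
    have "emeasure (distr (uniform_measure lborel (cball 0 1 - {0})) direction_measure f) X
        = emeasure (uniform_measure lborel (cball 0 1 - {0})) (f -` X)"
      using X fd by (subst emeasure_distr) auto
    also have "\<dots> = emeasure lborel (sphere_cone X) / emeasure lborel (cball (0::'a) 1 - {0})"
      using Xf by (subst emeasure_uniform_measure) (auto simp: cone)
    also have "\<dots> = surface_area X / surface_area (sphere (0::'a) 1)"
      using sphere_cone_borel[OF Xb Xs] unfolding surface_area_def sphere_cone_sphere
      by (simp add: mult.commute[of "of_nat DIM('a)"] divide_mult_eq)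
    finally show "emeasure direction_measure X
        = emeasure (distr (uniform_measure lborel (cball 0 1 - {0})) direction_measure f) X"
      using emeasure_direction_measure[OF X] by simp
  qed simp
qed

lemma line_len_scale:
  assumes A: "A \<in> sets borel" and c: "c > 0"
  shows "line_len u A p = ennreal c * line_len (c *\<^sub>R u) A p"
proof -
  have "(\<lambda>t. indicator A (p + t *\<^sub>R u) :: ennreal) \<in> borel_measurable borel"
    using A by measurable
  then show ?thesis
    using nn_integral_real_affine[of "\<lambda>t. indicator A (p + t *\<^sub>R u)" c 0] c
    by (simp add: line_len_eq_nn_integral A mult.commute)
qed

lemma nn_integral_lborel_affine:
  fixes f :: "'a::euclidean_space \<Rightarrow> ennreal"
  assumes [measurable]: "f \<in> borel_measurable borel" and c: "c > 0"
  shows "(\<integral>\<^sup>+x. f x \<partial>lborel) = ennreal (c ^ DIM('a)) * (\<integral>\<^sup>+x. f (p + c *\<^sub>R x) \<partial>lborel)"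
  using c by (subst lborel_affine[of c p]) (simp_all add: nn_integral_density nn_integral_distr nn_integral_cmult)

text \<open>On \<open>{\<rho>..2 * \<rho>}\<close>, of length \<open>\<rho>\<close>, the integrand
  is at least its value at \<open>2 * \<rho>\<close>. This yields
  \<open>1 / (2 * (2 * \<rho>) ^ (d - 1))\<close>, and \<open>2 * \<rho>\<close> is at most
  \<open>4 * R\<close>. Here \<open>\<rho>\<close> stands for the distance of two points of
  \<open>cball 0 R\<close>.\<close>

lemma radial_weight_bound:
  fixes d :: nat
  assumes d: "0 < d" and \<rho>: "0 < \<rho>" "\<rho> \<le> 2 * R"
  shows "ennreal (1 / (2 * (4 * R) ^ (d - 1))) \<le> (\<integral>\<^sup>+s. indicator {\<rho>..2 * \<rho>} s * ennreal (1 / s ^ d) \<partial>lborel)"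
proof -
  obtain k where k: "d = Suc k" using d by (cases d) auto
  have "(2 * \<rho>) ^ k \<le> (4 * R) ^ k" using \<rho> by (intro power_mono) auto
  then have "1 / (2 * (4 * R) ^ k) \<le> 1 / (2 * (2 * \<rho>) ^ k)"
    using \<rho> by (intro divide_left_mono) auto
  also have "\<dots> = (1 / (2 * \<rho>) ^ d) * \<rho>" using \<rho> by (simp add: k)
  finally have "ennreal (1 / (2 * (4 * R) ^ (d - 1))) \<le> ennreal ((1 / (2 * \<rho>) ^ d) * \<rho>)"
    by (intro ennreal_leI) (simp add: k)
  also have "\<dots> = ennreal (1 / (2 * \<rho>) ^ d) * (\<integral>\<^sup>+s. indicator {\<rho>..2 * \<rho>} s \<partial>lborel)"
    using \<rho> ennreal_mult[of "1 / (2 * \<rho>) ^ d" \<rho>] by simp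
  also have "\<dots> = (\<integral>\<^sup>+s. ennreal (1 / (2 * \<rho>) ^ d) * indicator {\<rho>..2 * \<rho>} s \<partial>lborel)"
    by (simp add: nn_integral_cmult)
  also have "\<dots> \<le> (\<integral>\<^sup>+s. indicator {\<rho>..2 * \<rho>} s * ennreal (1 / s ^ d) \<partial>lborel)"
  proof (rule nn_integral_mono)
    fix s :: real
    have "1 / (2 * \<rho>) ^ d \<le> 1 / s ^ d" if "\<rho> \<le> s" "s \<le> 2 * \<rho>"
      using that \<rho> power_mono[of s "2 * \<rho>" d] by (intro divide_left_mono) auto
    then show "ennreal (1 / (2 * \<rho>) ^ d) * indicator {\<rho>..2 * \<rho>} s \<le> indicator {\<rho>..2 * \<rho>} s * ennreal (1 / s ^ d)"
      by (auto simp del: power_mult_distrib split: split_indicator intro!: ennreal_leI)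
  qed
  finally show ?thesis .
qed

text \<open>Polar coordinates about \<open>p\<close> restricted to the shell \<open>1/2 \<le> \<bar>y\<bar> \<le> 1\<close>: a point \<open>q\<close> is hit as
  \<open>q = p + s y\<close> exactly for \<open>\<bar>q - p\<bar> \<le> s \<le> 2 \<bar>q - p\<bar>\<close>, with Jacobian \<open>s\<^sup>-\<^sup>d\<close>.\<close>

lemma shell_chord_bound:
  fixes G :: "'a::euclidean_space set"
  assumes G[measurable]: "G \<in> sets borel" and GR: "G \<subseteq> cball 0 R" and p: "p \<in> cball 0 R"
  shows "ennreal (1 / (2 * (4 * R) ^ (DIM('a) - 1))) * emeasure lborel G
     \<le> (\<integral>\<^sup>+y. indicator {y. 1 / 2 \<le> norm y \<and> norm y \<le> 1} y * line_len y G p \<partial>lborel)"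
proof -
  define C where "C = {y::'a. 1 / 2 \<le> norm y \<and> norm y \<le> 1}"
  let ?d = "DIM('a)"
  have C[measurable]: "C \<in> sets borel" unfolding C_def by measurable
  have hit: "indicator C ((q - p) /\<^sub>R s) = (indicator {norm (q - p)..2 * norm (q - p)} s :: ennreal)"
    if "0 < s" for q s
  proof -
    have "norm ((q - p) /\<^sub>R s) = norm (q - p) / s" using that by (simp add: divide_inverse_commute)
    then show ?thesis using that by (auto simp: C_def indicator_def pos_divide_le_eq pos_le_divide_eq)
  qed
  have inner: "(\<integral>\<^sup>+y. indicator C y * indicator G (p + s *\<^sub>R y) \<partial>lborel)
      = (\<integral>\<^sup>+q. indicator G q * (indicator {norm (q - p)..2 * norm (q - p)} s * ennreal (1 / s ^ ?d)) \<partial>lborel)"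
    if s: "0 < s" for s
  proof -
    have "(\<integral>\<^sup>+q. indicator G q * (indicator {norm (q - p)..2 * norm (q - p)} s * ennreal (1 / s ^ ?d)) \<partial>lborel)
       = (\<integral>\<^sup>+q. ennreal (1 / s ^ ?d) * (indicator C ((q - p) /\<^sub>R s) * indicator G q) \<partial>lborel)"
      using s by (intro nn_integral_cong) (simp add: hit mult_ac)
    also have "\<dots> = ennreal (1 / s ^ ?d) * (\<integral>\<^sup>+q. indicator C ((q - p) /\<^sub>R s) * indicator G q \<partial>lborel)"
      by (rule nn_integral_cmult) measurable
    also have "\<dots> = ennreal (1 / s ^ ?d) * (ennreal (s ^ ?d)
        * (\<integral>\<^sup>+y. indicator C ((p + s *\<^sub>R y - p) /\<^sub>R s) * indicator G (p + s *\<^sub>R y) \<partial>lborel))"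
      by (subst nn_integral_lborel_affine[OF _ s, of _ p]) measurable
    also have "\<dots> = (\<integral>\<^sup>+y. indicator C y * indicator G (p + s *\<^sub>R y) \<partial>lborel)"
      using s by (simp add: mult.assoc[symmetric] ennreal_mult[symmetric])
    finally show ?thesis ..
  qed
  have "ennreal (1 / (2 * (4 * R) ^ (?d - 1))) * emeasure lborel G
      = (\<integral>\<^sup>+q. indicator G q * ennreal (1 / (2 * (4 * R) ^ (?d - 1))) \<partial>lborel)"
    by (subst nn_integral_multc) (auto simp: mult.commute)
  also have "\<dots> \<le> (\<integral>\<^sup>+q. indicator G q *
      (\<integral>\<^sup>+s. indicator {norm (q - p)..2 * norm (q - p)} s * ennreal (1 / s ^ ?d) \<partial>lborel) \<partial>lborel)"
  proof (rule nn_integral_mono_AE)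
    \<comment> \<open>The radial bound needs a positive distance, so the single point
      \<open>p\<close> is discarded.\<close>
    have "AE q in lborel. q \<noteq> p" by (rule AE_lborel_singleton)
    then show "AE q in lborel. indicator G q * ennreal (1 / (2 * (4 * R) ^ (?d - 1)))
       \<le> indicator G q * (\<integral>\<^sup>+s. indicator {norm (q - p)..2 * norm (q - p)} s * ennreal (1 / s ^ ?d) \<partial>lborel)"
    proof eventually_elim
      case (elim q)
      have "norm (q - p) \<le> 2 * R" if "q \<in> G"
        using norm_triangle_ineq4[of q p] p that GR by force
      then show ?case
        using elim radial_weight_bound[of ?d "norm (q - p)" R] by (auto split: split_indicator)
    qed
  qed
  \<comment> \<open>Off \<open>p\<close> the indicator already forces \<open>s > 0\<close>. This is
    made explicit because, once the integrals are exchanged, the substitution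
    \<open>q = p + s y\<close> is available only for positive \<open>s\<close>.\<close>
  also have "\<dots> = (\<integral>\<^sup>+q. \<integral>\<^sup>+s. indicator {0<..} s * (indicator G q *
      (indicator {norm (q - p)..2 * norm (q - p)} s * ennreal (1 / s ^ ?d))) \<partial>lborel \<partial>lborel)"
  proof (rule nn_integral_cong_AE)
    have "AE q in lborel. q \<noteq> p" by (rule AE_lborel_singleton)
    then show "AE q in lborel. indicator G q *
      (\<integral>\<^sup>+s. indicator {norm (q - p)..2 * norm (q - p)} s * ennreal (1 / s ^ ?d) \<partial>lborel)
      = (\<integral>\<^sup>+s. indicator {0<..} s * (indicator G q *
      (indicator {norm (q - p)..2 * norm (q - p)} s * ennreal (1 / s ^ ?d))) \<partial>lborel)"
    proof eventually_elim
      case (elim q)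
      then have pos: "0 < norm (q - p)" by simp
      have "indicator {norm (q - p)..2 * norm (q - p)} s * ennreal (1 / s ^ ?d)
         = indicator {0<..} s * (indicator {norm (q - p)..2 * norm (q - p)} s * ennreal (1 / s ^ ?d))" for s
        using pos by (auto split: split_indicator)
      then show ?case
        by (subst nn_integral_cmult[symmetric]) (auto intro!: nn_integral_cong simp: mult_ac)
    qed
  qed
  also have "\<dots> = (\<integral>\<^sup>+s. \<integral>\<^sup>+q. indicator {0<..} s * (indicator G q *
      (indicator {norm (q - p)..2 * norm (q - p)} s * ennreal (1 / s ^ ?d))) \<partial>lborel \<partial>lborel)"
  proof (rule lborel_pair.Fubini')
    have "(\<lambda>(s, q). indicator {0<..} s * (indicator G q *
        ((if norm (q - p) \<le> s \<and> s \<le> 2 * norm (q - p) then 1 else 0) * ennreal (1 / s ^ ?d))))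
      \<in> borel_measurable (lborel \<Otimes>\<^sub>M lborel)"
      by measurable
    then show "(\<lambda>(s, q). indicator {0<..} s * (indicator G q *
        (indicator {norm (q - p)..2 * norm (q - p)} s * ennreal (1 / s ^ ?d))))
      \<in> borel_measurable (lborel \<Otimes>\<^sub>M lborel)"
      by (simp add: indicator_def)
  qed
  also have "\<dots> = (\<integral>\<^sup>+s. indicator {0<..} s * (\<integral>\<^sup>+y. indicator C y * indicator G (p + s *\<^sub>R y) \<partial>lborel) \<partial>lborel)"
  proof (rule nn_integral_cong)
    fix s :: real
    show "(\<integral>\<^sup>+q. indicator {0<..} s * (indicator G q *
      (indicator {norm (q - p)..2 * norm (q - p)} s * ennreal (1 / s ^ ?d))) \<partial>lborel)
      = indicator {0<..} s * (\<integral>\<^sup>+y. indicator C y * indicator G (p + s *\<^sub>R y) \<partial>lborel)"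
      by (cases "0 < s") (simp_all add: inner)
  qed
  also have "\<dots> \<le> (\<integral>\<^sup>+s. \<integral>\<^sup>+y. indicator C y * indicator G (p + s *\<^sub>R y) \<partial>lborel \<partial>lborel)"
    by (intro nn_integral_mono) (auto split: split_indicator)
  also have "\<dots> = (\<integral>\<^sup>+y. \<integral>\<^sup>+s. indicator C y * indicator G (p + s *\<^sub>R y) \<partial>lborel \<partial>lborel)"
    by (intro lborel_pair.Fubini') measurable
  also have "\<dots> = (\<integral>\<^sup>+y. indicator C y * line_len y G p \<partial>lborel)"
    by (intro nn_integral_cong) (simp add: nn_integral_cmult line_len_eq_nn_integral)
  finally show ?thesis unfolding C_def .
qed

text \<open>Half of the constant in \<open>shell_chord_bound\<close>, where 1/2 is the least norm in
  the shell, divided by the volume of the punctured ball from which directions are projected. The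
  type argument fixes the dimension.\<close>

definition chord_const :: "'a::euclidean_space itself \<Rightarrow> real \<Rightarrow> ennreal" where
  "chord_const _ R = ennreal (1 / (4 * (4 * R) ^ (DIM('a) - 1))) / emeasure lborel (cball (0::'a) 1 - {0})"

text \<open>With the direction obtained by projecting a point \<open>y\<close> of the punctured
  ball, only the shell is kept. There the length in the unit direction is \<open>norm y\<close>
  times the length in the parameter of \<open>y\<close>, hence at least half of it.\<close>

lemma mean_chord_bound:
  fixes G :: "'a::euclidean_space set"
  assumes G[measurable]: "G \<in> sets borel" and GR: "G \<subseteq> cball 0 R" and p: "p \<in> cball 0 R"
    and s: "s \<in> borel_measurable direction_measure" "\<And>u. s u = u \<or> s u = - u"
  shows "chord_const TYPE('a) R * emeasure lborel G \<le> (\<integral>\<^sup>+v. line_len (s v) G p \<partial>direction_measure)"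
proof -
  obtain b :: 'a where b: "norm b = 1" using norm_Basis nonempty_Basis by blast
  let ?f = "\<lambda>y. if y = 0 then b else y /\<^sub>R norm y"
  let ?C = "{y::'a. 1 / 2 \<le> norm y \<and> norm y \<le> 1}"
  let ?K = "cball (0::'a) 1 - {0}"
  note f = direction_measure_eq_distr[OF b]
  \<comment> \<open>Length is even in the direction, so it does not depend on the representative
    chosen by \<open>s\<close>.\<close>
  have sl: "line_len (s v) G p = line_len v G p" for v
    using s(2)[of v] by (auto simp: line_len_minus)
  have lm: "(\<lambda>v. line_len (s v) G p) \<in> borel_measurable direction_measure"
  proof -
    have "(\<lambda>v. \<integral>\<^sup>+t. indicator G (p + t *\<^sub>R s v) \<partial>lborel) \<in> borel_measurable direction_measure"
      using s(1) by measurable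
    then show ?thesis by (simp add: line_len_eq_nn_integral)
  qed
  have lf: "(\<lambda>y. line_len (?f y) G p) \<in> borel_measurable borel"
    using measurable_compose[OF f(1) lm] by (simp add: sl)
  have "(\<integral>\<^sup>+v. line_len (s v) G p \<partial>direction_measure)
      = (\<integral>\<^sup>+y. line_len (?f y) G p \<partial>uniform_measure lborel ?K)"
    using f(1) lm by (subst f(2), subst nn_integral_distr) (simp_all add: sl measurable_cong_sets)
  also have "\<dots> = (\<integral>\<^sup>+y. line_len (?f y) G p * indicator ?K y \<partial>lborel) / emeasure lborel ?K"
    using lf by (subst nn_integral_uniform_measure) auto
  finally have avg: "(\<integral>\<^sup>+v. line_len (s v) G p \<partial>direction_measure)
      = (\<integral>\<^sup>+y. line_len (?f y) G p * indicator ?K y \<partial>lborel) / emeasure lborel ?K" .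
  have shell: "(\<integral>\<^sup>+y. ennreal (1 / 2) * (indicator ?C y * line_len y G p) \<partial>lborel) / emeasure lborel ?K
      \<le> (\<integral>\<^sup>+y. line_len (?f y) G p * indicator ?K y \<partial>lborel) / emeasure lborel ?K"
  proof (intro divide_right_mono_ennreal nn_integral_mono)
    fix y :: 'a
    show "ennreal (1 / 2) * (indicator ?C y * line_len y G p) \<le> line_len (?f y) G p * indicator ?K y"
    proof (cases "y \<in> ?C")
      case True
      then have y: "0 < norm y" by auto
      have "ennreal (1 / 2) * line_len y G p \<le> ennreal (norm y) * line_len y G p"
        using True by (intro mult_right_mono ennreal_leI) auto
      also have "\<dots> = line_len (y /\<^sub>R norm y) G p"
        using y by (subst line_len_scale[OF G y, of "y /\<^sub>R norm y"]) simp
      finally show ?thesis using True y by (auto simp: indicator_def)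
    qed simp
  qed
  have "ennreal (1 / (4 * (4 * R) ^ (DIM('a) - 1))) * emeasure lborel G
      \<le> (\<integral>\<^sup>+y. ennreal (1 / 2) * (indicator ?C y * line_len y G p) \<partial>lborel)"
  proof -
    have [measurable]: "(\<lambda>y. line_len y G p) \<in> borel_measurable borel"
    proof -
      have "(\<lambda>y. \<integral>\<^sup>+t. indicator G (p + t *\<^sub>R y) \<partial>lborel) \<in> borel_measurable borel" by measurable
      then show ?thesis by (simp add: line_len_eq_nn_integral)
    qed
    have "0 \<le> R" using p norm_ge_zero[of p] by (simp del: norm_ge_zero)
    then have "ennreal (1 / (4 * (4 * R) ^ (DIM('a) - 1))) * emeasure lborel G
       = ennreal (1 / 2) * (ennreal (1 / (2 * (4 * R) ^ (DIM('a) - 1))) * emeasure lborel G)"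
      unfolding mult.assoc[symmetric] by (subst ennreal_mult[symmetric]) auto
    also have "\<dots> \<le> ennreal (1 / 2) * (\<integral>\<^sup>+y. indicator ?C y * line_len y G p \<partial>lborel)"
      by (intro mult_left_mono shell_chord_bound assms) auto
    also have "\<dots> = (\<integral>\<^sup>+y. ennreal (1 / 2) * (indicator ?C y * line_len y G p) \<partial>lborel)"
      by (subst nn_integral_cmult) auto
    finally show ?thesis .
  qed
  from order_trans[OF divide_right_mono_ennreal[OF this] shell]
  have "ennreal (1 / (4 * (4 * R) ^ (DIM('a) - 1))) * emeasure lborel G / emeasure lborel ?K
      \<le> (\<integral>\<^sup>+v. line_len (s v) G p \<partial>direction_measure)"
    unfolding avg .
  then show ?thesis
    by (simp add: chord_const_def divide_ennreal_def mult_ac)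
qed

text \<open>The finite volume of the ball matters here: division by infinity would give 0.\<close>

lemma chord_const_pos: "0 < R \<Longrightarrow> 0 < chord_const TYPE('a::euclidean_space) R"
  using emeasure_bounded_finite[of "cball (0::'a) 1 - {0}"]
  by (simp add: chord_const_def ennreal_zero_less_divide bounded_diff)

section \<open>Expected decrease under one random symmetrization\<close>

lemma emeasure_Diff_eq:
  assumes "A \<in> sets M" "B \<in> sets M" and fin: "emeasure M A < \<infinity>" and eq: "emeasure M A = emeasure M B"
  shows "emeasure M (A - B) = emeasure M (B - A)"
proof -
  have fin': "emeasure M (A \<inter> B) \<noteq> \<infinity>"
    using emeasure_mono[of "A \<inter> B" A M] fin assms(1) by (auto simp: top_unique)
  have "emeasure M (A - B) = emeasure M A - emeasure M (A \<inter> B)"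
    using emeasure_Diff[OF fin', of A] assms by (simp add: Diff_Int)
  moreover have "emeasure M (B - A) = emeasure M B - emeasure M (A \<inter> B)"
    using emeasure_Diff[OF fin', of B] assms by (simp add: Diff_Int)
  ultimately show ?thesis using eq by simp
qed

lemma emeasure_sym_diff_family_measurable:
  fixes B :: "'a::euclidean_space set"
  assumes [measurable]: "Measurable.pred (M \<Otimes>\<^sub>M borel) (\<lambda>p. snd p \<in> A (fst p))" "B \<in> sets borel"
  shows "(\<lambda>w. emeasure lborel (sym_diff (A w) B)) \<in> borel_measurable M"
proof -
  let ?Q = "{p \<in> space (M \<Otimes>\<^sub>M lborel). (snd p \<in> A (fst p)) \<noteq> (snd p \<in> B)}"
  have "Measurable.pred (M \<Otimes>\<^sub>M lborel) (\<lambda>p. (snd p \<in> A (fst p)) \<noteq> (snd p \<in> B))"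
    by measurable
  then have "?Q \<in> sets (M \<Otimes>\<^sub>M lborel)" unfolding pred_def .
  then have "(\<lambda>w. emeasure lborel (Pair w -` ?Q)) \<in> borel_measurable M"
    by (rule lborel.measurable_emeasure_Pair)
  moreover have "Pair w -` ?Q = sym_diff (A w) B" if "w \<in> space M" for w
    using that by (auto simp: space_pair_measure)
  ultimately show ?thesis by (simp cong: measurable_cong)
qed

text \<open>Equal volumes make the two one-sided differences of \<open>A\<close> and the ball each
  of volume half of \<open>X A\<close>. The gain, averaged over directions by Fubini, is at least
  \<open>chord_const\<close> times the product of these volumes, a quarter of
  \<open>(X A)\<^sup>2\<close>; clearing the quarter produces \<open>4 * R\<close>.\<close>

lemma mean_sym_diff_symmetral:
  fixes A :: "'a::euclidean_space set"
  assumes A[measurable]: "A \<in> sets borel" and AR: "A \<subseteq> cball 0 R" and R: "0 \<le> R" "r \<le> R"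
    and vol: "emeasure lborel A = emeasure lborel (cball (0::'a) r)"
    and s[measurable]: "s \<in> borel_measurable direction_measure" and s2: "\<And>u. s u = u \<or> s u = - u"
  defines "X \<equiv> \<lambda>E. emeasure lborel (sym_diff E (cball 0 r))"
  shows "ennreal (4 * R) * (\<integral>\<^sup>+v. X (open_symmetral (s v) A) \<partial>direction_measure)
      + chord_const TYPE('a) R * (X A)\<^sup>2 \<le> ennreal (4 * R) * X A"
proof -
  let ?B = "cball (0::'a) r" and ?D = "direction_measure :: 'a measure"
  let ?c = "chord_const TYPE('a) R"
  interpret D: prob_space ?D by (rule prob_space_direction_measure)
  interpret DL: pair_sigma_finite lborel ?D ..
  have [measurable]: "?B \<in> sets borel" by simp
  have BR: "?B \<subseteq> cball 0 R" using R by (simp add: subset_cball)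
  have fin: "emeasure lborel A < \<infinity>"
    using vol emeasure_lborel_cball_finite[of "0::'a" r] by simp
  have ab: "emeasure lborel (?B - A) = emeasure lborel (A - ?B)"
    using emeasure_Diff_eq[of A lborel ?B] fin vol by simp
  have XA: "X A = 2 * emeasure lborel (A - ?B)"
    unfolding X_def by (subst plus_emeasure[symmetric]) (auto simp: ab mult_2)
  have Xm: "(\<lambda>v. X (open_symmetral (s v) A)) \<in> borel_measurable ?D"
  proof -
    have "Measurable.pred (?D \<Otimes>\<^sub>M borel) (\<lambda>p. snd p \<in> A)" by measurable
    from emeasure_sym_diff_family_measurable[OF open_symmetral_family_measurable[OF this s]]
    show ?thesis by (simp add: X_def)
  qed
  have Lm: "(\<lambda>(p, v). line_len (s v) (?B - A) p) \<in> borel_measurable (lborel \<Otimes>\<^sub>M ?D)"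
  proof -
    have "Measurable.pred (?D \<Otimes>\<^sub>M borel) (\<lambda>p. snd p \<in> ?B - A)"
      by (rule pred_sets2[OF _ measurable_snd]) simp
    from measurable_pair_swap[OF line_len_family_measurable[OF this s]]
    show ?thesis by (simp cong: measurable_cong_sets sets_pair_measure_cong)
  qed
  have Lm': "(\<lambda>(p, v). indicator (A - ?B) p * line_len (s v) (?B - A) p) \<in> borel_measurable (lborel \<Otimes>\<^sub>M ?D)"
  proof -
    have "(indicator (A - ?B) :: 'a \<Rightarrow> ennreal) \<in> borel_measurable lborel"
      using A by (intro borel_measurable_indicator) simp
    from borel_measurable_times_ennreal[OF measurable_compose[OF measurable_fst this] Lm]
    show ?thesis by (simp add: split_beta')
  qed
  have su: "norm (s v) = 1" if "v \<in> space ?D" for v using that s2[of v] by auto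
  let ?I = "\<integral>\<^sup>+v. \<integral>\<^sup>+p. indicator (A - ?B) p * line_len (s v) (?B - A) p \<partial>lborel \<partial>?D"
  have "?c * emeasure lborel (?B - A) * emeasure lborel (A - ?B)
      = (\<integral>\<^sup>+p. indicator (A - ?B) p * (?c * emeasure lborel (?B - A)) \<partial>lborel)"
    by (subst nn_integral_multc) (auto simp: mult_ac)
  also have "\<dots> \<le> (\<integral>\<^sup>+p. indicator (A - ?B) p * (\<integral>\<^sup>+v. line_len (s v) (?B - A) p \<partial>?D) \<partial>lborel)"
    using AR BR by (intro nn_integral_mono) (auto split: split_indicator intro!: mean_chord_bound s s2)
  also have "\<dots> = (\<integral>\<^sup>+p. \<integral>\<^sup>+v. indicator (A - ?B) p * line_len (s v) (?B - A) p \<partial>?D \<partial>lborel)"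
    using Lm by (intro nn_integral_cong nn_integral_cmult[symmetric]) (auto dest: measurable_Pair2)
  also have "\<dots> = ?I"
    using DL.Fubini'[OF Lm'] by simp
  finally have I: "?c * emeasure lborel (?B - A) * emeasure lborel (A - ?B) \<le> ?I" .
  have "ennreal R * (\<integral>\<^sup>+v. X (open_symmetral (s v) A) \<partial>?D) + ?I
      = (\<integral>\<^sup>+v. ennreal R * X (open_symmetral (s v) A)
          + (\<integral>\<^sup>+p. indicator (A - ?B) p * line_len (s v) (?B - A) p \<partial>lborel) \<partial>?D)"
    using Xm lborel.borel_measurable_nn_integral[of "\<lambda>v p. indicator (A - ?B) p * line_len (s v) (?B - A) p" ?D]
      measurable_pair_swap[OF Lm']
    by (subst nn_integral_add) (auto simp: nn_integral_cmult split_beta')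
  also have "\<dots> \<le> (\<integral>\<^sup>+v. ennreal R * X A \<partial>?D)"
    unfolding X_def by (intro nn_integral_mono emeasure_sym_diff_symmetral A AR R su)
  also have "\<dots> = ennreal R * X A"
    by (simp add: D.emeasure_space_1 del: space_direction_measure)
  finally have 1: "ennreal R * (\<integral>\<^sup>+v. X (open_symmetral (s v) A) \<partial>?D) + ?I \<le> ennreal R * X A" .
  have "?c * (X A)\<^sup>2 = 4 * (?c * emeasure lborel (?B - A) * emeasure lborel (A - ?B))"
    by (simp add: XA ab power2_eq_square mult_ac)
  also have "\<dots> \<le> 4 * ?I" using I by (intro mult_left_mono) auto
  finally have "ennreal (4 * R) * (\<integral>\<^sup>+v. X (open_symmetral (s v) A) \<partial>?D) + ?c * (X A)\<^sup>2
     \<le> 4 * (ennreal R * (\<integral>\<^sup>+v. X (open_symmetral (s v) A) \<partial>?D) + ?I)"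
    using R by (simp add: ennreal_mult distrib_left mult.assoc add_left_mono)
  also have "\<dots> \<le> 4 * (ennreal R * X A)" by (intro mult_left_mono 1) auto
  also have "\<dots> = ennreal (4 * R) * X A" using R by (simp add: ennreal_mult mult.assoc)
  finally show ?thesis .
qed

subsection \<open>Almost sure convergence\<close>

lemma ennreal_bounded_multiples_zero:
  fixes e W :: ennreal
  assumes "\<And>n. of_nat n * e \<le> W" and "W < \<infinity>"
  shows "e = 0"
proof (rule ccontr)
  assume "e \<noteq> 0"
  then have "(SUP n. of_nat n * e) = top"
    by (simp add: SUP_mult_right_ennreal[symmetric] ennreal_SUP_of_nat_eq_top ennreal_top_mult)
  then have "top \<le> W"
    using SUP_least[of UNIV "\<lambda>n. of_nat n * e" W] assms(1) by metis
  then show False using assms(2) by (simp add: top_unique)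
qed

text \<open>The infimum \<open>Y\<close> of the decreasing sequence is its limit. Each step costs at
  least \<open>c\<close> times the integral of \<open>Y\<^sup>2\<close>, an amount independent of
  \<open>n\<close>, while the initial budget is finite; so this integral vanishes.\<close>

lemma AE_decreasing_tendsto_0:
  fixes X :: "nat \<Rightarrow> 'w \<Rightarrow> ennreal" and k c :: ennreal
  assumes [measurable]: "\<And>n. X n \<in> borel_measurable M"
    and dec: "\<And>n w. w \<in> space M \<Longrightarrow> X (Suc n) w \<le> X n w"
    and fin: "k * (\<integral>\<^sup>+w. X 0 w \<partial>M) < \<infinity>" and c: "0 < c"
    and step: "\<And>n. k * (\<integral>\<^sup>+w. X (Suc n) w \<partial>M) + c * (\<integral>\<^sup>+w. (X n w)\<^sup>2 \<partial>M) \<le> k * (\<integral>\<^sup>+w. X n w \<partial>M)"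
  shows "AE w in M. (\<lambda>n. X n w) \<longlonglongrightarrow> 0"
proof -
  define Y where "Y w = (INF n. X n w)" for w
  have [measurable]: "Y \<in> borel_measurable M" unfolding Y_def by measurable
  let ?e = "c * (\<integral>\<^sup>+w. (Y w)\<^sup>2 \<partial>M)"
  have Yle: "?e \<le> c * (\<integral>\<^sup>+w. (X n w)\<^sup>2 \<partial>M)" for n
    by (intro mult_left_mono nn_integral_mono power_mono) (auto simp: Y_def intro: INF_lower)
  \<comment> \<open>The telescoped step inequality, with the accumulated losses kept on the left to
    avoid subtraction in \<open>ennreal\<close>.\<close>
  have "k * (\<integral>\<^sup>+w. X n w \<partial>M) + of_nat n * ?e \<le> k * (\<integral>\<^sup>+w. X 0 w \<partial>M)" for n
  proof (induction n)
    case (Suc n)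
    have "k * (\<integral>\<^sup>+w. X (Suc n) w \<partial>M) + of_nat (Suc n) * ?e
        = (k * (\<integral>\<^sup>+w. X (Suc n) w \<partial>M) + ?e) + of_nat n * ?e"
      by (simp add: distrib_right add_ac)
    also have "\<dots> \<le> k * (\<integral>\<^sup>+w. X n w \<partial>M) + of_nat n * ?e"
      by (intro add_right_mono order_trans[OF add_left_mono[OF Yle[of n]] step])
    finally show ?case using Suc.IH by (rule order_trans)
  qed simp
  then have "of_nat n * ?e \<le> k * (\<integral>\<^sup>+w. X 0 w \<partial>M)" for n
    by (meson le_iff_add add.commute order_trans add_increasing zero_le order_refl)
  then have "?e = 0" using fin by (rule ennreal_bounded_multiples_zero)
  then have "(\<integral>\<^sup>+w. (Y w)\<^sup>2 \<partial>M) = 0" using c by auto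
  then have "AE w in M. Y w = 0"
    by (subst (asm) nn_integral_0_iff_AE) auto
  then show ?thesis
  proof (rule AE_mp, intro AE_I2 impI)
    fix w assume w: "w \<in> space M" "Y w = 0"
    have "decseq (\<lambda>n. X n w)" using dec[OF w(1)] by (intro decseq_SucI)
    then have "(\<lambda>n. X n w) \<longlonglongrightarrow> Y w" unfolding Y_def by (rule LIMSEQ_INF)
    with w show "(\<lambda>n. X n w) \<longlonglongrightarrow> 0" by simp
  qed
qed

section \<open>Iterated open symmetrals as random sets\<close>

primrec open_iter :: "(nat \<Rightarrow> 'a::euclidean_space) \<Rightarrow> 'a set \<Rightarrow> nat \<Rightarrow> 'a set" where
  "open_iter U A 0 = A"
| "open_iter U A (Suc n) = open_symmetral (U n) (open_iter U A n)"

text \<open>Dependence on the first \<open>n\<close> directions alone is what lets the independence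
  of the next direction be used.\<close>

lemma open_iter_cong: "(\<And>k. k < n \<Longrightarrow> U k = V k) \<Longrightarrow> open_iter U A n = open_iter V A n"
  by (induction n) auto

lemma open_iter_borel: "A \<in> sets borel \<Longrightarrow> open_iter U A n \<in> sets borel"
  by (induction n) auto

lemma emeasure_open_iter:
  "A \<in> sets borel \<Longrightarrow> (\<And>k. norm (U k) = 1) \<Longrightarrow> emeasure lborel (open_iter U A n) = emeasure lborel A"
  by (induction n) (auto simp: emeasure_open_symmetral open_iter_borel)

lemma open_iter_subset_cball:
  "A \<subseteq> cball 0 R \<Longrightarrow> (\<And>k. norm (U k) = 1) \<Longrightarrow> open_iter U A n \<subseteq> cball 0 R"
  by (induction n) (simp_all add: open_symmetral_subset_cball)

lemma open_iter_family_measurable: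
  assumes A[measurable]: "A \<in> sets borel" and s[measurable]: "\<And>k. (\<lambda>w. s w k) \<in> borel_measurable M"
  shows "Measurable.pred (M \<Otimes>\<^sub>M borel) (\<lambda>p. snd p \<in> open_iter (s (fst p)) A n)"
proof (induction n)
  case (Suc n)
  show ?case
    using open_symmetral_family_measurable[OF Suc s[of n]] by simp
qed simp

text \<open>The gain term is dropped and the finite positive factor \<open>R\<close>
  cancelled.\<close>

lemma emeasure_sym_diff_symmetral_le:
  fixes A :: "'a::euclidean_space set"
  assumes A[measurable]: "A \<in> sets borel" and AR: "A \<subseteq> cball 0 R" and R: "0 < R" "r \<le> R" and u: "norm u = 1"
  shows "emeasure lborel (sym_diff (open_symmetral u A) (cball 0 r)) \<le> emeasure lborel (sym_diff A (cball 0 r))"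
proof -
  let ?X = "\<lambda>E. emeasure lborel (sym_diff E (cball (0::'a) r))"
  have "ennreal R * ?X (open_symmetral u A) \<le> ennreal R * ?X A"
    using emeasure_sym_diff_symmetral[OF A AR _ R(2) u] R(1)
    by (meson add_increasing2 le_iff_add less_imp_le order_trans zero_le)
  then show ?thesis using R(1) by (simp add: ennreal_mult_le_mult_iff)
qed

text \<open>Independence enters by splitting the sequence: \<open>comb_seq n U V\<close> takes its
  first \<open>n\<close> directions from \<open>U\<close> and the rest from an independent copy
  \<open>V\<close>. For fixed \<open>U\<close> the iterate is a fixed set, to which the one-step
  mean estimate applies.\<close>

lemma random_open_iter_tendsto:
  fixes A :: "'a::euclidean_space set"
  assumes A[measurable]: "A \<in> sets borel" and AR: "A \<subseteq> cball 0 R" and R: "0 < R" "r \<le> R"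
    and vol: "emeasure lborel A = emeasure lborel (cball (0::'a) r)"
    and s[measurable]: "s \<in> borel_measurable direction_measure" and s2: "\<And>u. s u = u \<or> s u = - u"
  shows "AE U in random_directions.
     (\<lambda>n. emeasure lborel (sym_diff (open_iter (\<lambda>k. s (U k)) A n) (cball 0 r))) \<longlonglongrightarrow> 0"
proof -
  let ?B = "cball (0::'a) r" and ?D = "direction_measure :: 'a measure"
  let ?c = "chord_const TYPE('a) R"
  define \<Omega> where "\<Omega> = (random_directions :: (nat \<Rightarrow> 'a) measure)"
  have \<Omega>_eq: "\<Omega> = PiM UNIV (\<lambda>_. ?D)" by (simp add: \<Omega>_def random_directions_def)
  interpret D: prob_space ?D by (rule prob_space_direction_measure)
  interpret sequence_space ?D ..
  interpret \<Omega>: prob_space \<Omega> unfolding \<Omega>_eq by (rule prob_space_axioms)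
  define A' where "A' U n = open_iter (\<lambda>k. s (U k)) A n" for U n
  define X where "X n U = emeasure lborel (sym_diff (A' U n) ?B)" for n U
  have unit: "norm (s (U k)) = 1" if "U \<in> space \<Omega>" for U k
  proof -
    have "U k \<in> space ?D" using that by (auto simp: \<Omega>_eq space_PiM)
    then show ?thesis using s2[of "U k"] by auto
  qed
  have A'b: "A' U n \<in> sets borel" for U n
    unfolding A'_def by (rule open_iter_borel[OF A])
  have A'R: "A' U n \<subseteq> cball 0 R" and A'vol: "emeasure lborel (A' U n) = emeasure lborel ?B"
    if "U \<in> space \<Omega>" for U n
    unfolding A'_def using open_iter_subset_cball[OF AR] emeasure_open_iter[OF A] unit[OF that] vol by auto
  have Xm[measurable]: "X n \<in> borel_measurable \<Omega>" for n
  proof -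
    have "(\<lambda>U. s (U k)) \<in> borel_measurable \<Omega>" for k unfolding \<Omega>_eq by measurable
    from emeasure_sym_diff_family_measurable[OF open_iter_family_measurable[OF A this]]
    show ?thesis by (simp add: X_def[abs_def] A'_def)
  qed
  have "AE U in \<Omega>. (\<lambda>n. X n U) \<longlonglongrightarrow> 0"
  proof (rule AE_decreasing_tendsto_0[where k="ennreal (4 * R)" and c="?c"])
    show "X (Suc n) U \<le> X n U" if "U \<in> space \<Omega>" for n U
      using emeasure_sym_diff_symmetral_le[OF A'b A'R[OF that] R unit[OF that]]
      by (simp add: X_def A'_def)
    have "X 0 U \<le> emeasure lborel A + emeasure lborel ?B" for U
      unfolding X_def A'_def by (auto intro!: order_trans[OF emeasure_subadditive] add_mono emeasure_mono)
    then have "(\<integral>\<^sup>+U. X 0 U \<partial>\<Omega>) \<le> (\<integral>\<^sup>+U. emeasure lborel A + emeasure lborel ?B \<partial>\<Omega>)"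
      by (intro nn_integral_mono)
    also have "\<dots> < \<infinity>"
      using vol emeasure_lborel_cball_finite[of "0::'a" r] by (simp add: \<Omega>.emeasure_space_1)
    finally show "ennreal (4 * R) * (\<integral>\<^sup>+U. X 0 U \<partial>\<Omega>) < \<infinity>"
      by (simp add: ennreal_mult_less_top)
    show "0 < ?c" using R(1) by (rule chord_const_pos)
    fix n
    \<comment> \<open>Index \<open>n\<close> of the combined sequence is \<open>V 0\<close>, the
      direction applied in step \<open>Suc n\<close>.\<close>
    have comb: "X (Suc n) (comb_seq n U V) = emeasure lborel (sym_diff (open_symmetral (s (V 0)) (A' U n)) ?B)" for U V
    proof -
      have "A' (comb_seq n U V) n = A' U n"
        unfolding A'_def by (rule open_iter_cong) (simp add: comb_seq_def)
      then show ?thesis by (simp add: X_def A'_def comb_seq_def)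
    qed
    have cm: "(\<lambda>(U, V). comb_seq n U V) \<in> measurable (\<Omega> \<Otimes>\<^sub>M \<Omega>) \<Omega>"
      unfolding \<Omega>_eq by measurable
    \<comment> \<open>Only the coordinate 0 of \<open>V\<close> enters, and it is distributed as a
      single direction.\<close>
    have inner: "(\<integral>\<^sup>+V. X (Suc n) (comb_seq n U V) \<partial>\<Omega>)
        = (\<integral>\<^sup>+v. emeasure lborel (sym_diff (open_symmetral (s v) (A' U n)) ?B) \<partial>?D)" for U
    proof -
      have "Measurable.pred (?D \<Otimes>\<^sub>M borel) (\<lambda>p. snd p \<in> A' U n)" using A'b by measurable
      from emeasure_sym_diff_family_measurable[OF open_symmetral_family_measurable[OF this s]]
      have m: "(\<lambda>v. emeasure lborel (sym_diff (open_symmetral (s v) (A' U n)) ?B)) \<in> borel_measurable ?D"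
        by simp
      have "distr \<Omega> ?D (\<lambda>V. V 0) = ?D"
        unfolding \<Omega>_eq using PiM_component[of 0] by simp
      then have "(\<integral>\<^sup>+v. emeasure lborel (sym_diff (open_symmetral (s v) (A' U n)) ?B) \<partial>?D)
          = (\<integral>\<^sup>+v. emeasure lborel (sym_diff (open_symmetral (s v) (A' U n)) ?B) \<partial>distr \<Omega> ?D (\<lambda>V. V 0))"
        by simp
      also have "\<dots> = (\<integral>\<^sup>+V. X (Suc n) (comb_seq n U V) \<partial>\<Omega>)"
        using m unfolding comb by (subst nn_integral_distr) (simp_all add: \<Omega>_eq)
      finally show ?thesis ..
    qed
    \<comment> \<open>Gluing two independent sequences reproduces the law of one sequence.\<close>
    have "(\<integral>\<^sup>+U. X (Suc n) U \<partial>\<Omega>) = (\<integral>\<^sup>+U. X (Suc n) U \<partial>distr (\<Omega> \<Otimes>\<^sub>M \<Omega>) \<Omega> (\<lambda>(U, V). comb_seq n U V))"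
      using PiM_comb_seq[of n] unfolding \<Omega>_eq by simp
    also have "\<dots> = (\<integral>\<^sup>+p. X (Suc n) (case p of (U, V) \<Rightarrow> comb_seq n U V) \<partial>(\<Omega> \<Otimes>\<^sub>M \<Omega>))"
      by (rule nn_integral_distr[OF cm]) simp
    also have "\<dots> = (\<integral>\<^sup>+U. \<integral>\<^sup>+V. X (Suc n) (comb_seq n U V) \<partial>\<Omega> \<partial>\<Omega>)"
      using measurable_compose[OF cm Xm] by (subst \<Omega>.nn_integral_fst[symmetric]) auto
    finally have E: "(\<integral>\<^sup>+U. X (Suc n) U \<partial>\<Omega>) = (\<integral>\<^sup>+U. \<integral>\<^sup>+V. X (Suc n) (comb_seq n U V) \<partial>\<Omega> \<partial>\<Omega>)" .
    have im: "(\<lambda>U. \<integral>\<^sup>+V. X (Suc n) (comb_seq n U V) \<partial>\<Omega>) \<in> borel_measurable \<Omega>"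
      using \<Omega>.borel_measurable_nn_integral_fst[OF measurable_compose[OF cm Xm], of "Suc n"] by simp
    have "ennreal (4 * R) * (\<integral>\<^sup>+U. X (Suc n) U \<partial>\<Omega>) + ?c * (\<integral>\<^sup>+U. (X n U)\<^sup>2 \<partial>\<Omega>)
        = (\<integral>\<^sup>+U. ennreal (4 * R) * (\<integral>\<^sup>+V. X (Suc n) (comb_seq n U V) \<partial>\<Omega>) + ?c * (X n U)\<^sup>2 \<partial>\<Omega>)"
      using im unfolding E by (subst nn_integral_add) (auto simp: nn_integral_cmult)
    also have "\<dots> \<le> (\<integral>\<^sup>+U. ennreal (4 * R) * X n U \<partial>\<Omega>)"
      unfolding inner unfolding X_def using R
      by (intro nn_integral_mono mean_sym_diff_symmetral A'b A'R A'vol s s2) auto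
    also have "\<dots> = ennreal (4 * R) * (\<integral>\<^sup>+U. X n U \<partial>\<Omega>)"
      by (simp add: nn_integral_cmult)
    finally show "ennreal (4 * R) * (\<integral>\<^sup>+U. X (Suc n) U \<partial>\<Omega>) + ?c * (\<integral>\<^sup>+U. (X n U)\<^sup>2 \<partial>\<Omega>)
        \<le> ennreal (4 * R) * (\<integral>\<^sup>+U. X n U \<partial>\<Omega>)" .
  qed (rule Xm)
  then show ?thesis unfolding \<Omega>_def X_def A'_def .
qed

section \<open>Transfer to Steiner symmetrals of Lebesgue sets\<close>

lemma steiner_iter_cong_null:
  assumes A': "A' \<in> sets borel" and N: "N \<in> null_sets lborel" and sub: "sym_diff A A' \<subseteq> N"
    and U: "\<And>k. norm (U k) = 1"
  shows "\<exists>N'\<in>null_sets lborel. sym_diff (steiner_iter U A n) (open_iter U A' n) \<subseteq> N'"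
proof (induction n)
  case 0
  then show ?case using N sub by auto
next
  case (Suc n)
  then obtain N' where "N' \<in> null_sets lborel" "sym_diff (steiner_iter U A n) (open_iter U A' n) \<subseteq> N'" by blast
  then show ?case
    using steiner_symmetral_cong_null[OF open_iter_borel[OF A'] _ _ U] by simp
qed

text \<open>Opposite directions give the same symmetral, so each direction may be replaced by its
  measurable representative.\<close>

lemma steiner_iter_pm:
  assumes "\<And>u. s u = u \<or> s u = - u"
  shows "steiner_iter (\<lambda>k. s (U k)) A n = steiner_iter U A n"
proof (induction n)
  case (Suc n)
  then show ?case using assms[of "U n"] steiner_symmetral_minus[of "U n"] by auto
qed simp

lemma measure_cball_vol_radius:
  fixes F :: "'a::euclidean_space set"
  shows "measure lebesgue (cball (0::'a) (vol_radius F)) = measure lebesgue F"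
proof -
  let ?k = "measure lebesgue (cball (0::'a) 1)"
  have k: "?k = unit_ball_vol (real DIM('a))" "?k > 0"
    by (simp_all add: content_cball)
  have "vol_radius F ^ DIM('a) = measure lebesgue F / ?k"
  \<comment> \<open>The power laws need a positive base; for volume 0 the value of
    \<open>powr\<close> at base 0 makes the radius 0, as required.\<close>
  proof (cases "measure lebesgue F = 0")
    case False
    then have pos: "measure lebesgue F / ?k > 0" using k by (simp add: less_le)
    then have "vol_radius F ^ DIM('a) = vol_radius F powr real DIM('a)"
      using False unfolding vol_radius_def by (subst powr_realpow) simp_all
    also have "\<dots> = measure lebesgue F / ?k"
      using pos unfolding vol_radius_def powr_powr by simp
    finally show ?thesis .
  qed (simp add: vol_radius_def)
  moreover have "vol_radius F \<ge> 0" by (simp add: vol_radius_def)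
  ultimately show ?thesis
    using k by (auto simp: content_cball simp del: unit_ball_vol_pos)
qed

theorem theorem3p4:
  fixes F :: "'a::euclidean_space set"
  assumes "bounded F" and "caccioppoli F"
  shows "AE U in random_directions.
           (\<lambda>n. nikodym_dist (steiner_iter U F n) (cball 0 (vol_radius F))) \<longlonglongrightarrow> 0"
proof -
  have F: "F \<in> sets lebesgue" using assms(2) by (simp add: caccioppoli_def)
  define r where "r = vol_radius F"
  \<comment> \<open>A Borel set inside \<open>F\<close> that differs from it by a null set; the
    convergence result for open symmetrals is applied to \<open>A\<close>.\<close>
  obtain A N where A: "A \<in> sets borel" "A \<subseteq> F" and N: "N \<in> null_sets lborel" "F - A \<subseteq> N"
    using F by (elim sets_completionE) force
  have sd: "sym_diff F A \<subseteq> N" using A N by auto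
  obtain R0 where R0: "0 < R0" "F \<subseteq> cball 0 R0"
    using assms(1) unfolding bounded_pos by (auto simp: subset_eq)
  \<comment> \<open>A single radius has to enclose both the set and the target ball.\<close>
  define R where "R = max R0 r"
  have R: "0 < R" "r \<le> R" and AR: "A \<subseteq> cball 0 R"
    using R0 A(2) by (auto simp: R_def)
  have "emeasure lborel A = emeasure lebesgue F"
    using emeasure_lebesgue_cong_null[OF A(1) N(1) sd] by simp
  also have "\<dots> = ennreal (measure lebesgue F)"
    using bounded_set_imp_lmeasurable[OF assms(1) F] by (simp add: emeasure_eq_measure2)
  also have "\<dots> = emeasure lebesgue (cball (0::'a) r)"
    unfolding r_def by (subst measure_cball_vol_radius[symmetric]) (simp add: emeasure_eq_measure2)
  finally have vol: "emeasure lborel A = emeasure lborel (cball (0::'a) r)" by simp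
  obtain s :: "'a \<Rightarrow> 'a" where s: "s \<in> borel_measurable direction_measure" "\<And>u. s u = u \<or> s u = - u"
    using direction_section by metis
  from random_open_iter_tendsto[OF A(1) AR R vol s] show ?thesis
  proof (rule AE_mp, intro AE_I2 impI)
    fix U :: "nat \<Rightarrow> 'a" assume U: "U \<in> space random_directions"
      and lim: "(\<lambda>n. emeasure lborel (sym_diff (open_iter (\<lambda>k. s (U k)) A n) (cball 0 r))) \<longlonglongrightarrow> 0"
    have unit: "norm (s (U k)) = 1" for k
    proof -
      have "U k \<in> space direction_measure"
        using U by (auto simp: random_directions_def space_PiM)
      then show ?thesis using s(2)[of "U k"] by auto
    qed
    \<comment> \<open>For every unit sequence the two iterates agree up to a null set, so the
      distances are equal for each \<open>n\<close> and the limit carries over.\<close>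
    have "nikodym_dist (steiner_iter U F n) (cball 0 r)
        = emeasure lborel (sym_diff (open_iter (\<lambda>k. s (U k)) A n) (cball 0 r))" for n
    proof -
      obtain N' where N': "N' \<in> null_sets lborel"
        "sym_diff (steiner_iter U F n) (open_iter (\<lambda>k. s (U k)) A n) \<subseteq> N'"
        using steiner_iter_cong_null[OF A(1) N(1) sd, of "\<lambda>k. s (U k)" n] unit
        unfolding steiner_iter_pm[OF s(2)] by blast
      show ?thesis
        unfolding nikodym_dist_def
        by (rule emeasure_lebesgue_cong_null[OF _ N'(1)]) (use N'(2) open_iter_borel[OF A(1)] in auto)
    qed
    with lim show "(\<lambda>n. nikodym_dist (steiner_iter U F n) (cball 0 (vol_radius F))) \<longlonglongrightarrow> 0"
      by (simp add: r_def)
  qed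
qed

end
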